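(* Let $n\ge 3$ be a composite number, let $j$ be a proper divisor of $n$ (that is, $j\mid n$ and $0<j<n$), and let $k=\frac nj$. The quotient $\ell^j(n)/\langle\mathcal{R}_n,\nu\rangle$ is homeomorphic to: 1. $\mathscr{L}(j)$, if $k$ is odd; 2. the disjoint union $\mathscr{L}(j)\sqcup L_{2j}(1,3,5,\dots,j-1)$, if $k$ is even and $j$ is even; 3. the disjoint union $\mathscr{L}(j)\sqcup\big(\mathcal{C}_{L_j(1,3,\dots,j-2)}/\{([X],0)\sim([-X],0)\}\big)$, if $k$ is even and $j$ is odd, where $[X]\in L_j(1,3,\dots,j-2)$ denotes the class of a point $X\in\ell^{\,j}_-(n)$ with last coordinate equal to $0$.
   Context: $\mathbb{S}^m$ is the unit sphere in $\mathbb{R}^{m+1}$, $\mathbb{S}^{-1}=\emptyset$. Let $R_\theta\in GL_2(\mathbb{R})$ be the counterclockwise rotation matrix of angle $\theta$. $\mathcal{R}_n\in GL_{n-1}(\mathbb{R})$ is the block-diagonal matrix with diagonal blocks $R_{1\cdot\frac{2\pi}{n}},R_{2\cdot\frac{2\pi}{n}},\dots,R_{\frac{n-1}{2}\cdot\frac{2\pi}{n}}$ if $n$ is odd, and $R_{1\cdot\frac{2\pi}{n}},\dots,R_{\frac{n-2}{2}\cdot\frac{2\pi}{n}},-1$ if $n$ is even (last block of size $1$); $\nu(X)=-X$. The group $\langle\mathcal{R}_n,\nu\rangle\subset O(n-1)$ acts on $\mathbb{S}^{n-2}$ and preserves $\ell^j(n)=\ell^{\,j}_+(n)\cup\ell^{\,j}_-(n)$,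 where $\ell^{\,j}_\pm(n)=\{X\in\mathbb{S}^{n-2} : \mathcal{R}_n^j(X)=\pm X\}$. Space of shapes: for $m\ge3$, let $\mathcal{D}_m=\{(b,\dots,b)\}\subset\mathbb{C}^m$, let $\mathbb{L}(m)$ be the set of $(z_1,\dots,z_m)\in\mathbb{C}^m\smallsetminus\mathcal{D}_m$ with $z_1,\dots,z_m$ on a common real line in $\mathbb{C}$, let $\eta\colon\mathbb{C}^m\smallsetminus\mathcal{D}_m\to P(m)$ be the projection to the quotient by the diagonal action of the complex affine group $\{z\mapsto az+b: a\ne0\}$, and let $\mu\colon P(m)\to P(m)$ be induced by $(z_1,z_2,\dots,z_m)\mapsto(z_2,\dots,z_m,z_1)$. Then $\mathscr{L}(m)=\eta(\mathbb{L}(m))/\langle\mu\rangle$; it is homeomorphic to $\mathbb{S}^{m-2}/\langle\mathcal{R}_m,\nu\rangle$. By convention the same applies for small $m$: $\mathscr{L}(2)$ is a point and $\mathscr{L}(1)=\emptyset$. Orbifold lens spaces: for a positive integer $q$ and integers $p_1,\dots,p_m$ with $\gcd(p_1,\dots,p_m,q)=1$, $L_q(p_1,\dots,p_m)=\mathbb{S}^{2m-1}/\langle G\rangle$, where $\mathbb{S}^{2m-1}\subset\mathbb{C}^m$ is the unit sphere and $G(z_1,\dots,z_m)=(e^{2\pi i p_1/q}z_1,\dots,e^{2\pi i p_m/q}z_m)$. The parameter lists in the claim consist of consecutive odd integers; the empty list (for $j=1$) gives the empty space. Cone: $\mathcal{C}_A=A\times[0,1]/(A\times\{1\})$ is the closed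 cone over $A$ with apex at level $1$ and base $A\times\{0\}$; the cone over $\emptyset$ is a point. In case 3, $\ell^{\,j}_-(n)$ is the unit sphere of a $j$-dimensional coordinate subspace of $\mathbb{R}^{n-1}$ containing the last coordinate axis; the points $X\in\ell^{\,j}_-(n)$ with last coordinate $0$ form a sphere $\mathbb{S}^{j-2}$, which is identified with the unit sphere of $\mathbb{C}^{(j-1)/2}$ through the $2\times2$ blocks (in order) of $\mathcal{R}_n$ (pair $(x,y)\leftrightarrow x+iy$), so that $L_j(1,3,\dots,j-2)$ is a quotient of this sphere and $[X]$, $[-X]$ are the classes of $X$ and $-X$ in it. *)

theory Defs
  imports "HOL-Analysis.Analysis" "HOL-Algebra.Generated_Groups" "HOL-Algebra.Bij"
begin

section \<open>Topological constructions\<close>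

subsection \<open>Quotients\<close>

text \<open>The final topology on the image of \<open>f\<close>; by \<open>quotient_map_quotient_topology\<close> below it is
  the topology on \<open>f ` topspace X\<close> that makes \<open>f\<close> a quotient map.\<close>

definition quotient_topology :: "'a topology \<Rightarrow> ('a \<Rightarrow> 'b) \<Rightarrow> 'b topology" where
  "quotient_topology X f =
     topology (\<lambda>U. U \<subseteq> f ` topspace X \<and> openin X {x \<in> topspace X. f x \<in> U})"

lemma openin_quotient_topology:
  "openin (quotient_topology X f) U \<longleftrightarrow>
     U \<subseteq> f ` topspace X \<and> openin X {x \<in> topspace X. f x \<in> U}"
proof -
  let ?P = "\<lambda>U. U \<subseteq> f ` topspace X \<and> openin X {x \<in> topspace X. f x \<in> U}"
  have "?P (S \<inter> T)" if "?P S" "?P T" for S T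
  proof -
    have "{x \<in> topspace X. f x \<in> S \<inter> T} = {x \<in> topspace X. f x \<in> S} \<inter> {x \<in> topspace X. f x \<in> T}"
      by auto
    with that show ?thesis by auto
  qed
  moreover have "?P (\<Union>K)" if "\<forall>S\<in>K. ?P S" for K
  proof -
    have "{x \<in> topspace X. f x \<in> \<Union>K} = (\<Union>S\<in>K. {x \<in> topspace X. f x \<in> S})" by auto
    moreover have "openin X (\<Union>S\<in>K. {x \<in> topspace X. f x \<in> S})" using that by blast
    ultimately show ?thesis using that by auto
  qed
  ultimately have "istopology ?P" unfolding istopology_def by blast
  then show ?thesis by (simp add: quotient_topology_def topology_inverse')
qed

lemma topspace_quotient_topology [simp]:
  "topspace (quotient_topology X f) = f ` topspace X"
proof -
  have "{x \<in> topspace X. f x \<in> f ` topspace X} = topspace X" by auto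
  then have "openin (quotient_topology X f) (f ` topspace X)"
    by (simp add: openin_quotient_topology)
  then show ?thesis
    by (metis openin_quotient_topology openin_subset openin_topspace subset_antisym)
qed

lemma quotient_map_quotient_topology: "quotient_map X (quotient_topology X f) f"
  by (auto simp: quotient_map_def openin_quotient_topology)

text \<open>The quotient of \<open>X\<close> by the equivalence relation generated by \<open>r\<close>
  (for \<open>r\<close> relating only points of \<open>X\<close>).\<close>

definition generated_class :: "('a \<Rightarrow> 'a \<Rightarrow> bool) \<Rightarrow> 'a \<Rightarrow> 'a set" where
  "generated_class r x = {y. equivclp r x y}"

definition identify :: "'a topology \<Rightarrow> ('a \<Rightarrow> 'a \<Rightarrow> bool) \<Rightarrow> 'a set topology" where
  "identify X r = quotient_topology X (generated_class r)"

text \<open>\<open>orbit_space X F A\<close> is the quotient of the subspace \<open>A\<close> of \<open>X\<close> by the subgroup of the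
  group of bijections of \<open>X\<close> generated by \<open>F\<close>; it is meant for \<open>A\<close> preserved by that group.
  The elements of \<open>F\<close> are restricted since \<open>BijGroup\<close> consists of extensional functions.\<close>

definition generated_orbit :: "'a set \<Rightarrow> ('a \<Rightarrow> 'a) set \<Rightarrow> 'a \<Rightarrow> 'a set" where
  "generated_orbit E F x =
     {g x | g. g \<in> generate (BijGroup E) ((\<lambda>f. restrict f E) ` F)}"

definition orbit_space :: "'a topology \<Rightarrow> ('a \<Rightarrow> 'a) set \<Rightarrow> 'a set \<Rightarrow> 'a set topology" where
  "orbit_space X F A = quotient_topology (subtopology X A) (generated_orbit (topspace X) F)"

subsection \<open>Disjoint unions and cones\<close>

definition disjoint_sum :: "'a topology \<Rightarrow> 'b topology \<Rightarrow> ('a + 'b) topology"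
    (infixr \<open>\<squnion>\<^sub>t\<close> 65) where
  "X \<squnion>\<^sub>t Y = topology (\<lambda>U. U \<subseteq> topspace X <+> topspace Y \<and>
                            openin X (Inl -` U) \<and> openin Y (Inr -` U))"

lemma openin_disjoint_sum:
  "openin (X \<squnion>\<^sub>t Y) U \<longleftrightarrow>
     U \<subseteq> topspace X <+> topspace Y \<and> openin X (Inl -` U) \<and> openin Y (Inr -` U)"
proof -
  let ?P = "\<lambda>U. U \<subseteq> topspace X <+> topspace Y \<and> openin X (Inl -` U) \<and> openin Y (Inr -` U)"
  have "?P (S \<inter> T)" if "?P S" "?P T" for S T using that by auto
  moreover have "?P (\<Union>K)" if "\<forall>S\<in>K. ?P S" for K
    using that unfolding vimage_Union by blast
  ultimately have "istopology ?P" unfolding istopology_def by blast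
  then show ?thesis by (simp add: disjoint_sum_def topology_inverse')
qed

lemma topspace_disjoint_sum [simp]: "topspace (X \<squnion>\<^sub>t Y) = topspace X <+> topspace Y"
proof -
  have "Inl -` (topspace X <+> topspace Y) = topspace X"
    and "Inr -` (topspace X <+> topspace Y) = topspace Y" by auto
  then have "openin (X \<squnion>\<^sub>t Y) (topspace X <+> topspace Y)"
    by (simp add: openin_disjoint_sum)
  then show ?thesis
    by (metis openin_disjoint_sum openin_subset openin_topspace subset_antisym)
qed

text \<open>The apex is adjoined as a separate point and then glued to \<open>A \<times> {1}\<close>: for nonempty \<open>A\<close>
  this is \<open>A \<times> [0,1]\<close> with \<open>A \<times> {1}\<close> collapsed, and the cone over the empty space is a
  point.\<close>

definition cone_gluing :: "'a topology \<Rightarrow> ('a \<times> real) + unit \<Rightarrow> ('a \<times> real) + unit \<Rightarrow> bool" where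
  "cone_gluing A p q \<longleftrightarrow> (\<exists>a \<in> topspace A. p = Inl (a, 1) \<and> q = Inr ())"

definition cone :: "'a topology \<Rightarrow> (('a \<times> real) + unit) set topology" where
  "cone A = identify (prod_topology A (top_of_set {0..1}) \<squnion>\<^sub>t discrete_topology {()})
                     (cone_gluing A)"

definition cone_point :: "'a topology \<Rightarrow> 'a \<Rightarrow> real \<Rightarrow> (('a \<times> real) + unit) set" where
  "cone_point A a t = generated_class (cone_gluing A) (Inl (a, t))"

section \<open>The rotations and the fixed spheres\<close>

text \<open>\<open>\<real>\<^sup>n\<^sup>-\<^sup>1\<close> is \<open>Euclidean_space (n - 1)\<close>, with coordinates numbered from \<open>0\<close>. The \<open>t\<close>-th rotation
  block (\<open>t = 1, 2, \<dots>\<close>) acts on the coordinates \<open>2 * t - 2\<close> and \<open>2 * t - 1\<close>.\<close>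

definition rot :: "nat \<Rightarrow> (nat \<Rightarrow> real) \<Rightarrow> nat \<Rightarrow> real" where
  "rot n x = (\<lambda>i.
     let \<theta> = real (i div 2 + 1) * (2 * pi / real n) in
     if i \<ge> n - 1 then 0
     else if even n \<and> i = n - 2 then - x i
     else if even i then cos \<theta> * x i - sin \<theta> * x (i + 1)
     else sin \<theta> * x (i - 1) + cos \<theta> * x i)"

definition antipode :: "(nat \<Rightarrow> real) \<Rightarrow> nat \<Rightarrow> real" where
  "antipode x = (\<lambda>i. - x i)"

text \<open>\<open>nsphere (n - 2)\<close> is the unit sphere of \<open>Euclidean_space (n - 1)\<close> for \<open>n \<ge> 2\<close>.\<close>

definition ell_plus :: "nat \<Rightarrow> nat \<Rightarrow> (nat \<Rightarrow> real) set" where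
  "ell_plus j n = {x \<in> topspace (nsphere (n - 2)). (rot n ^^ j) x = x}"

definition ell_minus :: "nat \<Rightarrow> nat \<Rightarrow> (nat \<Rightarrow> real) set" where
  "ell_minus j n = {x \<in> topspace (nsphere (n - 2)). (rot n ^^ j) x = antipode x}"

definition ell :: "nat \<Rightarrow> nat \<Rightarrow> (nat \<Rightarrow> real) set" where
  "ell j n = ell_plus j n \<union> ell_minus j n"

definition ell_quotient :: "nat \<Rightarrow> nat \<Rightarrow> (nat \<Rightarrow> real) set topology" where
  "ell_quotient j n = orbit_space (nsphere (n - 2)) {rot n, antipode} (ell j n)"

section \<open>The space of collinear shapes\<close>

text \<open>\<open>\<complex>\<^sup>m\<close> is the product of \<open>m\<close> copies of \<open>\<complex>\<close>; its points are the functions on \<open>{..<m}\<close>,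
  extended by \<open>undefined\<close>.\<close>

definition complex_space :: "nat \<Rightarrow> (nat \<Rightarrow> complex) topology" where
  "complex_space m = product_topology (\<lambda>_. euclidean) {..<m}"

definition diagonal :: "nat \<Rightarrow> (nat \<Rightarrow> complex) set" where
  "diagonal m = {(\<lambda>i\<in>{..<m}. b) | b. True}"

definition collinear_configs :: "nat \<Rightarrow> (nat \<Rightarrow> complex) set" where
  "collinear_configs m =
     {z \<in> topspace (complex_space m) - diagonal m. collinear (z ` {..<m})}"

definition affine_class :: "nat \<Rightarrow> (nat \<Rightarrow> complex) \<Rightarrow> (nat \<Rightarrow> complex) set" where
  "affine_class m z = {(\<lambda>i\<in>{..<m}. a * z i + b) | a b. a \<noteq> 0}"

definition shape_space :: "nat \<Rightarrow> (nat \<Rightarrow> complex) set topology" where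
  "shape_space m =
     quotient_topology (subtopology (complex_space m) (topspace (complex_space m) - diagonal m))
                       (affine_class m)"

definition cyclic_shift :: "nat \<Rightarrow> (nat \<Rightarrow> complex) \<Rightarrow> nat \<Rightarrow> complex" where
  "cyclic_shift m z = (\<lambda>i\<in>{..<m}. z (Suc i mod m))"

text \<open>The induced map on classes.\<close>

definition shape_shift :: "nat \<Rightarrow> (nat \<Rightarrow> complex) set \<Rightarrow> (nat \<Rightarrow> complex) set" where
  "shape_shift m c = cyclic_shift m ` c"

lemma shape_shift_affine_class:
  "shape_shift m (affine_class m z) = affine_class m (cyclic_shift m z)"
proof -
  have eq: "cyclic_shift m (\<lambda>i\<in>{..<m}. a * z i + b) = (\<lambda>i\<in>{..<m}. a * cyclic_shift m z i + b)"
    for a b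
    by (auto simp: cyclic_shift_def fun_eq_iff)
  have "shape_shift m (affine_class m z) =
      {cyclic_shift m (\<lambda>i\<in>{..<m}. a * z i + b) | a b. a \<noteq> 0}"
    unfolding shape_shift_def affine_class_def by blast
  then show ?thesis unfolding eq affine_class_def .
qed

text \<open>For \<open>m = 1\<close> this is empty and for \<open>m = 2\<close> it is a point, as \<open>\<complex>\<^sup>m\<close> minus the diagonal is
  then empty, resp. a single affine orbit.\<close>

definition linear_shapes :: "nat \<Rightarrow> (nat \<Rightarrow> complex) set set topology" where
  "linear_shapes m =
     orbit_space (shape_space m) {shape_shift m} (affine_class m ` collinear_configs m)"

section \<open>Orbifold lens spaces\<close>

definition complex_sphere :: "nat \<Rightarrow> (nat \<Rightarrow> complex) topology" where
  "complex_sphere m = subtopology (complex_space m) {z. (\<Sum>i<m. (cmod (z i))\<^sup>2) = 1}"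

definition lens_rotation :: "nat \<Rightarrow> int list \<Rightarrow> (nat \<Rightarrow> complex) \<Rightarrow> nat \<Rightarrow> complex" where
  "lens_rotation q p z = (\<lambda>i\<in>{..<length p}. cis (2 * pi * real_of_int (p ! i) / real q) * z i)"

definition lens_class :: "nat \<Rightarrow> int list \<Rightarrow> (nat \<Rightarrow> complex) \<Rightarrow> (nat \<Rightarrow> complex) set" where
  "lens_class q p =
     generated_orbit (topspace (complex_sphere (length p))) {lens_rotation q p}"

definition lens_space :: "nat \<Rightarrow> int list \<Rightarrow> (nat \<Rightarrow> complex) set topology" where
  "lens_space q p =
     orbit_space (complex_sphere (length p)) {lens_rotation q p}
                 (topspace (complex_sphere (length p)))"

text \<open>The list of the odd positive integers smaller than \<open>j\<close>: it is \<open>1, 3, \<dots>, j - 1\<close> for even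
  \<open>j\<close> and \<open>1, 3, \<dots>, j - 2\<close> for odd \<open>j\<close>.\<close>

definition odds_below :: "nat \<Rightarrow> int list" where
  "odds_below j = map (\<lambda>s. 2 * int s + 1) [0..<j div 2]"

section \<open>The cone with antipodal points of its base identified\<close>

text \<open>Let \<open>n = j * k\<close> with \<open>k\<close> even and \<open>j\<close> odd. The \<open>j\<close>-th power of the \<open>t\<close>-th block of
  \<open>rot n\<close> is the rotation by \<open>2 * pi * t / k\<close>, which is \<open>-1\<close> iff \<open>t\<close> is an odd multiple of
  \<open>k / 2\<close>. Hence a point of \<open>ell_minus j n\<close> lives on the blocks \<open>t = (2 * s + 1) * k / 2\<close>,
  \<open>s < (j - 1) / 2\<close>, and on the last coordinate \<open>n - 2\<close>. The following map reads off the
  coordinates of these blocks, in order, as complex numbers.\<close>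

definition block_coords :: "nat \<Rightarrow> nat \<Rightarrow> (nat \<Rightarrow> real) \<Rightarrow> nat \<Rightarrow> complex" where
  "block_coords j k x =
     (\<lambda>s\<in>{..<j div 2}. Complex (x ((2 * s + 1) * k - 2)) (x ((2 * s + 1) * k - 1)))"

definition folded_cone :: "nat \<Rightarrow> nat \<Rightarrow> ((nat \<Rightarrow> complex) set \<times> real + unit) set set topology" where
  "folded_cone j n =
     (let p = odds_below j; L = lens_space j p; k = n div j in
      identify (cone L)
        (\<lambda>u v. \<exists>x \<in> ell_minus j n. x (n - 2) = 0 \<and>
           u = cone_point L (lens_class j p (block_coords j k x)) 0 \<and>
           v = cone_point L (lens_class j p (block_coords j k (antipode x))) 0))"

end

theory Submission
  imports Defs
begin

text \<open>The points fixed by \<open>R\<^sup>j\<close> and those sent to their antipodes form two disjoint closed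
  invariant sets, so the quotient is the disjoint sum of two orbit spaces. On the first set, the
  discrete Fourier transform turns a point into a real \<open>j\<close>-periodic sequence with sum zero and
  \<open>R\<close> into the shift; normalising collinear configurations by affine maps gives exactly these
  sequences up to real factors. The second set is empty for odd \<open>k\<close>. For even \<open>k\<close> only the
  blocks with index an odd multiple of \<open>k / 2\<close> are nonzero on it, where \<open>R\<close> acts by the odd powers
  of a primitive root of order \<open>2 j\<close>. For even \<open>j\<close> this is the lens space action. For odd \<open>j\<close>
  there is in addition the last coordinate, whose sign is changed by \<open>R\<close>; the half on which it is
  nonnegative is a cone over the equator, preserved by \<open>R\<^sup>2\<close>, and the remaining generator
  \<open>R\<^sup>j = - 1\<close> only identifies antipodal points of the equator. All comparisons are made between
  quotient maps with the same fibres out of a common space.\<close>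

section \<open>Quotient maps and disjoint sums\<close>

text \<open>The work lies in showing that maps are quotient maps. Collinear configurations form a
  noncompact space on which a unit direction of the supporting line cannot in general be chosen
  continuously. Hence the normalisation to a real sequence exists only locally, by projecting to the
  direction of one fixed configuration; local sections suffice to transfer the quotient property to
  the sphere. On the antipodal part compactness does this: continuous maps from compact to Hausdorff
  spaces are closed, and so are orbit maps of finite groups.

  The constants come from one cancellation. With \<open>h = k / 2\<close> and
  \<open>n = 2 * h * j\<close>, the block \<open>(2 * s + 1) * h\<close> is rotated by
  \<open>2 * pi * (2 * s + 1) / (2 * j)\<close>, in which \<open>k\<close> no longer occurs.
  Squaring this rotation halves the modulus, which gives the lens space of modulus \<open>j\<close>.

  The equivalence relations generated in the cone are never computed. Points are separated by
  functions that respect the generating pairs, and identified by exhibiting such pairs.\<close>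

lemma homeomorphic_space_same_fibres:
  assumes f: "quotient_map X Y f" and g: "quotient_map X Z g"
    and fg: "\<And>x y. x \<in> topspace X \<Longrightarrow> y \<in> topspace X \<Longrightarrow> f x = f y \<longleftrightarrow> g x = g y"
  shows "Y homeomorphic_space Z"
proof -
  obtain u where u: "continuous_map Y Z u" "\<And>x. x \<in> topspace X \<Longrightarrow> u (f x) = g x"
    using quotient_map_lift_exists[OF f quotient_imp_continuous_map[OF g]] fg by metis
  obtain v where v: "continuous_map Z Y v" "\<And>x. x \<in> topspace X \<Longrightarrow> v (g x) = f x"
    using quotient_map_lift_exists[OF g quotient_imp_continuous_map[OF f]] fg by metis
  have "homeomorphic_maps Y Z u v"
    unfolding homeomorphic_maps_def
    using u v quotient_imp_surjective_map[OF f] quotient_imp_surjective_map[OF g] by force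
  then show ?thesis
    by (auto simp: homeomorphic_space_def)
qed

lemma quotient_map_homeomorphic_space:
  assumes f: "quotient_map X Y f" and "Y homeomorphic_space Z"
  obtains g where "quotient_map X Z g"
    "\<And>x y. x \<in> topspace X \<Longrightarrow> y \<in> topspace X \<Longrightarrow> g x = g y \<longleftrightarrow> f x = f y"
proof -
  obtain h where h: "homeomorphic_map Y Z h"
    using assms homeomorphic_space by blast
  show thesis
  proof
    show "quotient_map X Z (h \<circ> f)"
      using f h quotient_map_compose by (auto simp: homeomorphic_map_def)
    show "(h \<circ> f) x = (h \<circ> f) y \<longleftrightarrow> f x = f y" if "x \<in> topspace X" "y \<in> topspace X" for x y
      using h that quotient_imp_surjective_map[OF f]
      by (auto simp: homeomorphic_map_def inj_on_def)
  qed
qed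

text \<open>Openness in \<open>Z\<close> is tested in \<open>C\<close>, where it is a local
  question: near \<open>c\<close> the preimage under \<open>q\<close> agrees with the preimage under
  \<open>s\<close> of the preimage under \<open>f\<close>, which is open by continuity of
  \<open>s\<close>. Sections at different points may be incompatible.\<close>

lemma quotient_map_local_sections:
  assumes q: "quotient_map C Z q" and f: "continuous_map X Z f"
    and sec: "\<And>c. c \<in> topspace C \<Longrightarrow> \<exists>N s. openin C N \<and> c \<in> N \<and>
      continuous_map (subtopology C N) X s \<and> (\<forall>d\<in>N. f (s d) = q d)"
  shows "quotient_map X Z f"
proof -
  have "f ` topspace X = topspace Z"
  proof
    show "f ` topspace X \<subseteq> topspace Z"
      using f by (simp add: continuous_map_image_subset_topspace)
    show "topspace Z \<subseteq> f ` topspace X"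
    proof
      fix z assume "z \<in> topspace Z"
      then obtain c where c: "c \<in> topspace C" "z = q c"
        using quotient_imp_surjective_map[OF q] by blast
      obtain N s where N: "c \<in> N" "continuous_map (subtopology C N) X s" "\<forall>d\<in>N. f (s d) = q d"
        using sec[OF c(1)] by blast
      then have "s c \<in> topspace X"
        using c(1) by (auto simp: continuous_map_def Pi_iff)
      then show "z \<in> f ` topspace X"
        using N c by force
    qed
  qed
  moreover have "openin Z U" if U: "U \<subseteq> topspace Z" "openin X {x \<in> topspace X. f x \<in> U}" for U
  proof -
    have "openin C {c \<in> topspace C. q c \<in> U}"
    proof (subst openin_subopen, clarify)
      fix c assume c: "c \<in> topspace C" "q c \<in> U"
      obtain N s where N: "openin C N" "c \<in> N" "continuous_map (subtopology C N) X s"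
        "\<forall>d\<in>N. f (s d) = q d"
        using sec[OF c(1)] by blast
      have "openin (subtopology C N)
          {d \<in> topspace (subtopology C N). s d \<in> {x \<in> topspace X. f x \<in> U}}"
        using N(3) U(2) openin_continuous_map_preimage by blast
      moreover have "{d \<in> topspace (subtopology C N). s d \<in> {x \<in> topspace X. f x \<in> U}}
          = {d \<in> N. q d \<in> U}"
        using N openin_subset[OF N(1)] by (auto simp: continuous_map_def Pi_iff)
      ultimately have "openin C {d \<in> N. q d \<in> U}"
        using N(1) openin_trans_full by fastforce
      moreover have "{d \<in> N. q d \<in> U} \<subseteq> {c \<in> topspace C. q c \<in> U}"
        using openin_subset[OF N(1)] by auto
      ultimately show "\<exists>T. openin C T \<and> c \<in> T \<and> T \<subseteq> {c \<in> topspace C. q c \<in> U}"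
        using N(2) c(2) by blast
    qed
    then show ?thesis
      using q U(1) by (simp add: quotient_map_def)
  qed
  ultimately show ?thesis
    using f unfolding quotient_map_def continuous_map_def by blast
qed

text \<open>Being closed and complementary, \<open>A\<close> and \<open>B\<close> are also open, so
  a set is open in \<open>X\<close> exactly when its traces on both pieces are.\<close>

lemma quotient_map_disjoint_union:
  assumes A: "closedin X A" and B: "closedin X B"
    and AB: "topspace X = A \<union> B" "A \<inter> B = {}"
    and f: "quotient_map (subtopology X A) Y f" and g: "quotient_map (subtopology X B) Z g"
  shows "quotient_map X (Y \<squnion>\<^sub>t Z) (\<lambda>x. if x \<in> A then Inl (f x) else Inr (g x))"
    (is "quotient_map _ _ ?h")
proof -
  have tA: "topspace (subtopology X A) = A" and tB: "topspace (subtopology X B) = B"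
    using AB by auto
  have "A = topspace X - B" "B = topspace X - A"
    using AB by auto
  then have oA: "openin X A" and oB: "openin X B"
    using A B by (metis openin_diff openin_topspace)+
  have fim: "f ` A = topspace Y" and gim: "g ` B = topspace Z"
    using quotient_imp_surjective_map[OF f] quotient_imp_surjective_map[OF g] unfolding tA tB by blast+
  have "?h ` A = Inl ` f ` A"
    by (simp add: image_image)
  moreover have "?h ` B = Inr ` g ` B"
    unfolding image_image by (rule image_cong) (use AB(2) in auto)
  ultimately have "?h ` (A \<union> B) = Inl ` f ` A \<union> Inr ` g ` B"
    unfolding image_Un by (rule arg_cong2)
  then have im: "?h ` topspace X = topspace (Y \<squnion>\<^sub>t Z)"
    by (simp add: AB fim gim Plus_def)
  have "openin X {x \<in> topspace X. ?h x \<in> U} = openin (Y \<squnion>\<^sub>t Z) U"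
    if U: "U \<subseteq> topspace (Y \<squnion>\<^sub>t Z)" for U
  proof -
    let ?P = "{x \<in> A. f x \<in> Inl -` U}" and ?Q = "{x \<in> B. g x \<in> Inr -` U}"
    have eq: "{x \<in> topspace X. ?h x \<in> U} = ?P \<union> ?Q"
      using AB by auto
    have "?P = A \<inter> (?P \<union> ?Q)" "?Q = B \<inter> (?P \<union> ?Q)"
      using AB by auto
    then have "openin X ?P \<and> openin X ?Q" if "openin X (?P \<union> ?Q)"
      using openin_Int[OF oA that] openin_Int[OF oB that] by simp
    then have "openin X (?P \<union> ?Q) \<longleftrightarrow> openin X ?P \<and> openin X ?Q"
      using openin_Un by blast
    also have "\<dots> \<longleftrightarrow> openin (subtopology X A) ?P \<and> openin (subtopology X B) ?Q"
      unfolding openin_open_subtopology[OF oA] openin_open_subtopology[OF oB] by blast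
    also have "\<dots> \<longleftrightarrow> openin Y (Inl -` U) \<and> openin Z (Inr -` U)"
    proof -
      have "Inl -` U \<subseteq> topspace Y" "Inr -` U \<subseteq> topspace Z"
        using U by auto
      then have "openin (subtopology X A) ?P = openin Y (Inl -` U)"
        "openin (subtopology X B) ?Q = openin Z (Inr -` U)"
        using f g unfolding quotient_map_def tA tB by blast+
      then show ?thesis
        by blast
    qed
    finally show ?thesis
      using U by (auto simp: eq openin_disjoint_sum)
  qed
  then show ?thesis
    unfolding quotient_map_def using im by blast
qed

lemma quotient_map_map_sum:
  assumes f: "quotient_map X X' f" and g: "quotient_map Y Y' g"
  shows "quotient_map (X \<squnion>\<^sub>t Y) (X' \<squnion>\<^sub>t Y') (map_sum f g)"
proof -
  have im: "map_sum f g ` topspace (X \<squnion>\<^sub>t Y) = topspace (X' \<squnion>\<^sub>t Y')"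
  proof -
    have "map_sum f g ` topspace (X \<squnion>\<^sub>t Y) = Inl ` f ` topspace X \<union> Inr ` g ` topspace Y"
      by (simp add: Plus_def image_Un image_image)
    then show ?thesis
      unfolding quotient_imp_surjective_map[OF f] quotient_imp_surjective_map[OF g]
      by (simp add: Plus_def)
  qed
  have "openin (X \<squnion>\<^sub>t Y) {x \<in> topspace (X \<squnion>\<^sub>t Y). map_sum f g x \<in> U} = openin (X' \<squnion>\<^sub>t Y') U"
    if U: "U \<subseteq> topspace (X' \<squnion>\<^sub>t Y')" for U
  proof -
    have "Inl -` {x \<in> topspace (X \<squnion>\<^sub>t Y). map_sum f g x \<in> U} = {x \<in> topspace X. f x \<in> Inl -` U}"
      "Inr -` {x \<in> topspace (X \<squnion>\<^sub>t Y). map_sum f g x \<in> U} = {x \<in> topspace Y. g x \<in> Inr -` U}"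
      by auto
    moreover have "Inl -` U \<subseteq> topspace X'" "Inr -` U \<subseteq> topspace Y'"
      using U by auto
    then have "openin X {x \<in> topspace X. f x \<in> Inl -` U} = openin X' (Inl -` U)"
      "openin Y {x \<in> topspace Y. g x \<in> Inr -` U} = openin Y' (Inr -` U)"
      using f g unfolding quotient_map_def by blast+
    moreover have "{x \<in> topspace (X \<squnion>\<^sub>t Y). map_sum f g x \<in> U} \<subseteq> topspace X <+> topspace Y"
      by auto
    ultimately show ?thesis
      using U unfolding openin_disjoint_sum topspace_disjoint_sum by simp
  qed
  then show ?thesis
    unfolding quotient_map_def using im by blast
qed

lemma continuous_map_from_disjoint_sum:
  assumes "continuous_map X Z (f \<circ> Inl)" "continuous_map Y Z (f \<circ> Inr)"
  shows "continuous_map (X \<squnion>\<^sub>t Y) Z f"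
proof -
  have "Inl -` {x \<in> topspace (X \<squnion>\<^sub>t Y). f x \<in> U} = {x \<in> topspace X. (f \<circ> Inl) x \<in> U}"
    "Inr -` {x \<in> topspace (X \<squnion>\<^sub>t Y). f x \<in> U} = {x \<in> topspace Y. (f \<circ> Inr) x \<in> U}" for U
    by auto
  with assms show ?thesis
    by (auto simp: continuous_map_def openin_disjoint_sum)
qed

lemma compact_space_disjoint_sum:
  assumes "compact_space X" "compact_space Y"
  shows "compact_space (X \<squnion>\<^sub>t Y)"
proof -
  have "continuous_map X (X \<squnion>\<^sub>t Y) Inl" "continuous_map Y (X \<squnion>\<^sub>t Y) Inr"
    by (auto simp: continuous_map_def openin_disjoint_sum vimage_def openin_subset Collect_conj_eq
        Int_absorb1 elim!: back_subst[where P = "openin _"] dest: openin_subset)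
  then have "compactin (X \<squnion>\<^sub>t Y) (Inl ` topspace X)" "compactin (X \<squnion>\<^sub>t Y) (Inr ` topspace Y)"
    using assms by (auto simp: compact_space_def intro: image_compactin)
  then have "compactin (X \<squnion>\<^sub>t Y) (Inl ` topspace X \<union> Inr ` topspace Y)"
    by (rule compactin_Un)
  then show ?thesis
    by (simp add: compact_space_def Plus_def)
qed

section \<open>Generated equivalence relations\<close>

lemma generated_class_eq_iff: "generated_class r x = generated_class r y \<longleftrightarrow> equivclp r x y"
proof -
  have "equivclp r x y \<longleftrightarrow> equivclp r x = equivclp r y"
    using equivp_evquivclp[of r] unfolding equivp_def by blast
  then show ?thesis
    by (auto simp: generated_class_def fun_eq_iff set_eq_iff)
qed

lemma generated_class_cong: "r x y \<Longrightarrow> generated_class r x = generated_class r y"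
  by (simp add: generated_class_eq_iff r_into_equivclp)

text \<open>A function constant on generating pairs is constant along every chain of them. This
  separates points of a glued space without a description of the generated relation.\<close>

lemma generated_class_invariant:
  assumes "generated_class r x = generated_class r y" and r: "\<And>u v. r u v \<Longrightarrow> F u = F v"
  shows "F x = F y"
proof -
  have "equivclp r x y"
    using assms(1) by (simp add: generated_class_eq_iff)
  then show ?thesis
    by (induction rule: equivclp_induct) (auto dest: r)
qed

section \<open>Orbits of two commuting maps of finite order\<close>

text \<open>Finite order makes every inverse a nonnegative power, and commutation sorts words, so
  the generated group consists of the maps \<open>(f ^^ i) o (g ^^ l)\<close>. Cyclic groups are the
  instances with \<open>f = g\<close>, since \<open>{f, f}\<close> is \<open>{f}\<close>.\<close>

locale commuting_maps =
  fixes E :: "'a set" and f g :: "'a \<Rightarrow> 'a" and N M :: nat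
  assumes f_in: "x \<in> E \<Longrightarrow> f x \<in> E" and g_in: "x \<in> E \<Longrightarrow> g x \<in> E"
    and f_order: "x \<in> E \<Longrightarrow> (f ^^ N) x = x" and g_order: "x \<in> E \<Longrightarrow> (g ^^ M) x = x"
    and N_pos: "N > 0" and M_pos: "M > 0"
    and commute: "x \<in> E \<Longrightarrow> f (g x) = g (f x)"
begin

lemma fpow_in: "x \<in> E \<Longrightarrow> (f ^^ i) x \<in> E"
  by (induction i) (auto simp: f_in)

lemma gpow_in: "x \<in> E \<Longrightarrow> (g ^^ i) x \<in> E"
  by (induction i) (auto simp: g_in)

lemma f_gpow: "x \<in> E \<Longrightarrow> f ((g ^^ l) x) = (g ^^ l) (f x)"
  by (induction l) (auto simp: commute gpow_in)

lemma fpow_gpow: "x \<in> E \<Longrightarrow> (f ^^ i) ((g ^^ l) x) = (g ^^ l) ((f ^^ i) x)"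
  by (induction i) (auto simp: f_gpow fpow_in)

lemma restrict_Bij:
  assumes h: "\<And>x. x \<in> E \<Longrightarrow> h x \<in> E" and "\<And>x. x \<in> E \<Longrightarrow> (h ^^ K) x = x" "K > 0"
  shows "restrict h E \<in> Bij E"
proof -
  obtain L where L: "K = Suc L"
    using assms(3) by (cases K) auto
  have hp: "(h ^^ i) x \<in> E" if "x \<in> E" for i x
    using that by (induction i) (auto simp: h)
  have "bij_betw h E E"
    by (rule bij_betw_byWitness[where f' = "h ^^ L"])
      (use assms(2) hp h in \<open>auto simp: L funpow_swap1\<close>)
  then show ?thesis
    by (simp add: Bij_def bij_betw_restrict_eq)
qed

lemma f_Bij: "restrict f E \<in> Bij E" and g_Bij: "restrict g E \<in> Bij E"
  using restrict_Bij[OF f_in f_order N_pos] restrict_Bij[OF g_in g_order M_pos] by auto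

lemma generators: "(\<lambda>h. restrict h E) ` {f, g} \<subseteq> carrier (BijGroup E)"
  using f_Bij g_Bij by (auto simp: BijGroup_def)

abbreviation "\<G> \<equiv> generate (BijGroup E) ((\<lambda>h. restrict h E) ` {f, g})"

lemma generate_Bij: "h \<in> \<G> \<Longrightarrow> h \<in> Bij E"
  using group.generate_incl[OF group_BijGroup generators] by (auto simp: BijGroup_def)

lemma mult_apply: "h \<in> Bij E \<Longrightarrow> h' \<in> Bij E \<Longrightarrow> x \<in> E \<Longrightarrow> (h \<otimes>\<^bsub>BijGroup E\<^esub> h') x = h (h' x)"
  by (simp add: BijGroup_def compose_def)

lemma inv_restrict_apply:
  assumes h: "\<And>x. x \<in> E \<Longrightarrow> h x \<in> E" and hK: "\<And>x. x \<in> E \<Longrightarrow> (h ^^ Suc L) x = x" and "x \<in> E"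
  shows "(inv\<^bsub>BijGroup E\<^esub> (restrict h E)) x = (h ^^ L) x"
proof -
  have B: "restrict h E \<in> Bij E"
    using restrict_Bij[OF h hK] by simp
  have hp: "(h ^^ i) y \<in> E" if "y \<in> E" for i y
    using that by (induction i) (auto simp: h)
  have "inv_into E (restrict h E) x = (h ^^ L) x"
    by (rule inv_into_f_eq)
      (use B hp \<open>x \<in> E\<close> hK[OF \<open>x \<in> E\<close>] in \<open>auto simp: Bij_def bij_betw_def\<close>)
  then show ?thesis
    using B \<open>x \<in> E\<close> by (simp add: inv_BijGroup)
qed

lemma generate_apply: "h \<in> \<G> \<Longrightarrow> \<exists>i l. \<forall>x\<in>E. h x = (f ^^ i) ((g ^^ l) x)"
proof (induction rule: generate.induct)
  case one
  have "\<forall>x\<in>E. \<one>\<^bsub>BijGroup E\<^esub> x = (f ^^ 0) ((g ^^ 0) x)"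
    by (simp add: BijGroup_def)
  then show ?case by blast
next
  case (incl h)
  then have "(\<forall>x\<in>E. h x = (f ^^ 1) ((g ^^ 0) x)) \<or> (\<forall>x\<in>E. h x = (f ^^ 0) ((g ^^ 1) x))"
    by auto
  then show ?case by blast
next
  case (inv h)
  \<comment> \<open>The inverse of \<open>f\<close> on \<open>E\<close> is the power
    \<open>N - 1\<close>, that of \<open>g\<close> the power \<open>M - 1\<close>.\<close>
  obtain N' M' where "N = Suc N'" "M = Suc M'"
    using N_pos M_pos by (metis Suc_pred)
  then have "(\<forall>x\<in>E. (inv\<^bsub>BijGroup E\<^esub> h) x = (f ^^ N') ((g ^^ 0) x)) \<or>
      (\<forall>x\<in>E. (inv\<^bsub>BijGroup E\<^esub> h) x = (f ^^ 0) ((g ^^ M') x))"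
    using inv inv_restrict_apply[OF f_in, where L = N'] inv_restrict_apply[OF g_in, where L = M'] f_order g_order
    by auto
  then show ?case by blast
next
  case (eng h1 h2)
  obtain i l i' l' where "\<forall>x\<in>E. h1 x = (f ^^ i) ((g ^^ l) x)" "\<forall>x\<in>E. h2 x = (f ^^ i') ((g ^^ l') x)"
    using eng.IH by blast
  then have "\<forall>x\<in>E. (h1 \<otimes>\<^bsub>BijGroup E\<^esub> h2) x = (f ^^ (i + i')) ((g ^^ (l + l')) x)"
    by (simp add: mult_apply generate_Bij[OF eng.hyps(1)] generate_Bij[OF eng.hyps(2)]
        fpow_in gpow_in funpow_add fpow_gpow)
  then show ?case by blast
qed

lemma apply_generate: "\<exists>h\<in>\<G>. \<forall>x\<in>E. h x = (f ^^ i) ((g ^^ l) x)"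
proof (induction i)
  case 0
  show ?case
  proof (induction l)
    case 0
    have "\<one>\<^bsub>BijGroup E\<^esub> \<in> \<G>" "\<forall>x\<in>E. \<one>\<^bsub>BijGroup E\<^esub> x = x"
      by (auto simp: BijGroup_def generate.one intro: generate.one[of "BijGroup E", simplified BijGroup_def, simplified])
    then show ?case unfolding funpow_0 by blast
  next
    case (Suc l)
    then obtain h where h: "h \<in> \<G>" "\<forall>x\<in>E. h x = (g ^^ l) x"
      unfolding funpow_0 by blast
    have "restrict g E \<in> \<G>"
      by (auto intro: generate.incl)
    then have "restrict g E \<otimes>\<^bsub>BijGroup E\<^esub> h \<in> \<G>"
      "\<forall>x\<in>E. (restrict g E \<otimes>\<^bsub>BijGroup E\<^esub> h) x = (g ^^ Suc l) x"
      using h by (auto simp: mult_apply generate_Bij gpow_in intro: generate.eng)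
    then show ?case unfolding funpow_0 by blast
  qed
next
  case (Suc i)
  then obtain h where h: "h \<in> \<G>" "\<forall>x\<in>E. h x = (f ^^ i) ((g ^^ l) x)"
    by blast
  have "restrict f E \<in> \<G>"
    by (auto intro: generate.incl)
  then have "restrict f E \<otimes>\<^bsub>BijGroup E\<^esub> h \<in> \<G>"
    "\<forall>x\<in>E. (restrict f E \<otimes>\<^bsub>BijGroup E\<^esub> h) x = (f ^^ Suc i) ((g ^^ l) x)"
    using h by (auto simp: mult_apply generate_Bij gpow_in fpow_in intro: generate.eng)
  then show ?case by blast
qed

lemma generated_orbit_eq:
  "x \<in> E \<Longrightarrow> generated_orbit E {f, g} x = {(f ^^ i) ((g ^^ l) x) | i l. True}"
  unfolding generated_orbit_def using generate_apply apply_generate by (auto; metis)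

lemma generated_orbit_eq_iff:
  assumes x: "x \<in> E" and y: "y \<in> E"
  shows "generated_orbit E {f, g} x = generated_orbit E {f, g} y \<longleftrightarrow> (\<exists>i l. y = (f ^^ i) ((g ^^ l) x))"
proof
  assume "generated_orbit E {f, g} x = generated_orbit E {f, g} y"
  moreover have "y \<in> generated_orbit E {f, g} y"
    unfolding generated_orbit_eq[OF y] by (metis (mono_tags, lifting) funpow_0 mem_Collect_eq)
  ultimately show "\<exists>i l. y = (f ^^ i) ((g ^^ l) x)"
    using generated_orbit_eq[OF x] by auto
next
  have sub: "generated_orbit E {f, g} ((f ^^ i) ((g ^^ l) u)) \<subseteq> generated_orbit E {f, g} u"
    if "u \<in> E" for i l u
  proof -
    have "(f ^^ i') ((g ^^ l') ((f ^^ i) ((g ^^ l) u))) = (f ^^ (i' + i)) ((g ^^ (l' + l)) u)" for i' l'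
      using that by (simp add: funpow_add fpow_gpow gpow_in fpow_in)
    then show ?thesis
      using that by (auto simp: generated_orbit_eq fpow_in gpow_in)
  qed
  assume "\<exists>i l. y = (f ^^ i) ((g ^^ l) x)"
  then obtain i l where y: "y = (f ^^ i) ((g ^^ l) x)"
    by blast
  have f1: "(f ^^ (N * i)) u = u" and g1: "(g ^^ (M * i)) u = u" if "u \<in> E" for i u
    using that f_order g_order by (induction i) (auto simp: funpow_add)
  \<comment> \<open>These exponents lead back from \<open>y\<close> to \<open>x\<close>:
    \<open>(N - 1) * i\<close> completes \<open>i\<close> to the multiple \<open>N * i\<close> of
    the order, and likewise for \<open>l\<close>.\<close>
  have "(f ^^ ((N - 1) * i)) ((g ^^ ((M - 1) * l)) y) = (f ^^ ((N - 1) * i + i)) ((g ^^ ((M - 1) * l + l)) x)"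
    unfolding y using x by (simp add: funpow_add fpow_gpow gpow_in fpow_in)
  moreover have "(N - 1) * i + i = N * i" "(M - 1) * l + l = M * l"
    using N_pos M_pos by (simp_all add: algebra_simps)
  ultimately have "x = (f ^^ ((N - 1) * i)) ((g ^^ ((M - 1) * l)) y)"
    using x by (simp add: f1 g1)
  then show "generated_orbit E {f, g} x = generated_orbit E {f, g} y"
    using sub[OF x, of i l] sub[of y "(N - 1) * i" "(M - 1) * l"] x y
    by (auto simp: fpow_in gpow_in)
qed

end

text \<open>The saturation of a closed set is the union of its preimages under the maps
  \<open>(f ^^ i) o (g ^^ l)\<close>; reducing the exponents modulo the orders makes this union
  finite, hence closed.\<close>

lemma closed_map_generated_orbit:
  assumes "commuting_maps (topspace X) f g N M"
    and f: "continuous_map X X f" and g: "continuous_map X X g"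
    and A: "A \<subseteq> topspace X" "\<And>x. x \<in> A \<Longrightarrow> f x \<in> A" "\<And>x. x \<in> A \<Longrightarrow> g x \<in> A"
  shows "closed_map (subtopology X A) (orbit_space X {f, g} A) (generated_orbit (topspace X) {f, g})"
    (is "closed_map _ _ ?q")
proof -
  interpret commuting_maps "topspace X" f g N M by fact
  have q: "quotient_map (subtopology X A) (orbit_space X {f, g} A) ?q"
    unfolding orbit_space_def by (rule quotient_map_quotient_topology)
  have pA: "(f ^^ i) ((g ^^ l) x) \<in> A" if "x \<in> A" for x i l
  proof -
    have "(g ^^ l) x \<in> A"
      using that by (induction l) (auto simp: A)
    then show ?thesis
      by (induction i) (auto simp: A)
  qed
  have cf: "continuous_map X X (f ^^ i)" and cg: "continuous_map X X (g ^^ i)" for i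
    by (induction i) (auto intro: continuous_map_compose f g simp: id_def)
  show ?thesis
    unfolding closed_map_def
  proof (intro allI impI)
    fix C assume C: "closedin (subtopology X A) C"
    then have CA: "C \<subseteq> A"
      using closedin_subset by fastforce
    have eq: "{x \<in> topspace (subtopology X A). ?q x \<in> ?q ` C} =
        (\<Union>i<N. \<Union>l<M. {x \<in> topspace (subtopology X A). ((f ^^ i) \<circ> (g ^^ l)) x \<in> C})" (is "?L = ?R")
    proof
      show "?L \<subseteq> ?R"
      proof clarsimp
        fix x c assume x: "x \<in> topspace X" "x \<in> A" and c: "c \<in> C" "?q x = ?q c"
        then obtain i l where "c = (f ^^ i) ((g ^^ l) x)"
          using generated_orbit_eq_iff[of x c] CA A(1) by blast
        then have "c = (f ^^ (i mod N)) ((g ^^ (l mod M)) x)"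
          using x by (simp add: funpow_mod_eq f_order g_order gpow_in)
        then show "\<exists>i\<in>{..<N}. \<exists>l\<in>{..<M}. (f ^^ i) ((g ^^ l) x) \<in> C"
          using c N_pos M_pos by (metis lessThan_iff mod_less_divisor)
      qed
      show "?R \<subseteq> ?L"
      proof clarsimp
        fix x i l assume x: "x \<in> topspace X" "x \<in> A" and c: "(f ^^ i) ((g ^^ l) x) \<in> C"
        then have "?q x = ?q ((f ^^ i) ((g ^^ l) x))"
          using generated_orbit_eq_iff fpow_in gpow_in by blast
        with c show "?q x \<in> ?q ` C" by blast
      qed
    qed
    have "closedin (subtopology X A) {x \<in> topspace (subtopology X A). ((f ^^ i) \<circ> (g ^^ l)) x \<in> C}" for i l
    proof -
      have "continuous_map (subtopology X A) (subtopology X A) ((f ^^ i) \<circ> (g ^^ l))"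
        using continuous_map_compose[OF cg cf, of i l] pA
        by (auto simp: continuous_map_in_subtopology continuous_map_from_subtopology)
      then show ?thesis
        using C closedin_continuous_map_preimage by blast
    qed
    then have "closedin (subtopology X A) ?R"
      by (auto intro!: closedin_Union)
    then have "closedin (subtopology X A) {x \<in> topspace (subtopology X A). ?q x \<in> ?q ` C}"
      unfolding eq .
    moreover have "?q ` C \<subseteq> topspace (orbit_space X {f, g} A)"
      using CA A(1) by (auto simp: orbit_space_def)
    ultimately show "closedin (orbit_space X {f, g} A) (?q ` C)"
      using q by (auto simp: quotient_map_closedin)
  qed
qed

section \<open>Fourier coefficients\<close>

text \<open>An integer exponent makes conjugation the negation of \<open>d\<close> and allows shifts
  of a frequency by any multiple of \<open>n\<close>.\<close>

definition unity :: "nat \<Rightarrow> int \<Rightarrow> complex" where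
  "unity n d = cis (2 * pi * real_of_int d / real n)"

lemma unity_add: "unity n (a + b) = unity n a * unity n b"
  by (simp add: unity_def cis_mult add_divide_distrib distrib_left)

lemma unity_0 [simp]: "unity n 0 = 1"
  by (simp add: unity_def)

lemma cnj_unity: "cnj (unity n d) = unity n (- d)"
  by (simp add: unity_def cis_cnj)

lemma norm_unity [simp]: "cmod (unity n d) = 1"
  by (simp add: unity_def)

lemma unity_power: "unity n d ^ m = unity n (d * int m)"
  unfolding unity_def Complex.DeMoivre by (rule arg_cong[of _ _ cis]) simp

lemma unity_multiple: "n > 0 \<Longrightarrow> unity n (int n * d) = 1"
  using cis_multiple_2pi[of "real_of_int d"] by (simp add: unity_def mult.assoc)

lemma unity_eq_1_iff: "n > 0 \<Longrightarrow> unity n d = 1 \<longleftrightarrow> int n dvd d"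
proof
  assume n: "n > 0" and "unity n d = 1"
  then have "cos (2 * pi * real_of_int d / real n) = 1"
    by (simp add: unity_def complex_eq_iff)
  then obtain c where "2 * pi * real_of_int d / real n = real_of_int c * 2 * pi"
    by (auto simp: cos_one_2pi_int)
  then have "real_of_int d = real_of_int (int n * c)"
    using n by (simp add: field_simps)
  then show "int n dvd d"
    by (metis dvd_triv_left of_int_eq_iff)
qed (auto simp: unity_multiple)

lemma unity_shift: "n > 0 \<Longrightarrow> unity n (d + int n * c) = unity n d"
  by (simp add: unity_add unity_multiple)

text \<open>Orthogonality of the characters of a cyclic group, by summing a geometric progression
  whose ratio is an \<open>n\<close>-th root of unity.\<close>

lemma sum_unity:
  assumes "n > 0"
  shows "(\<Sum>m<n. unity n (d * int m)) = (if int n dvd d then of_nat n else 0)"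
proof (cases "int n dvd d")
  case True
  then have "unity n d = 1"
    by (simp add: unity_eq_1_iff assms)
  then show ?thesis
    using True by (simp flip: unity_power)
next
  case False
  then have "unity n d \<noteq> 1"
    by (simp add: unity_eq_1_iff assms)
  moreover have "unity n d ^ n = 1"
    using unity_multiple[OF assms, of d] by (simp add: unity_power mult.commute)
  ultimately show ?thesis
    using False by (simp add: geometric_sum flip: unity_power)
qed

section \<open>Complex blocks of the rotation\<close>

definition ambient :: "nat \<Rightarrow> (nat \<Rightarrow> real) set" where
  "ambient n = {x. \<forall>i\<ge>n - 1. x i = 0}"

lemma ambientD: "x \<in> ambient n \<Longrightarrow> i \<ge> n - 1 \<Longrightarrow> x i = 0"
  by (simp add: ambient_def)

text \<open>Complex values turn a rotation block into multiplication by a root of unity. The block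
  of size one of even \<open>n\<close> is included as \<open>2 * t = n\<close>: the root is then -1,
  and the second coordinate vanishes on \<open>ambient n\<close>.\<close>

definition block :: "(nat \<Rightarrow> real) \<Rightarrow> nat \<Rightarrow> complex" where
  "block x t = Complex (x (2 * t - 2)) (x (2 * t - 1))"

lemma ambient_eqI:
  assumes "x \<in> ambient n" "y \<in> ambient n"
    and eq: "\<And>t. 1 \<le> t \<Longrightarrow> 2 * t \<le> n \<Longrightarrow> block x t = block y t"
  shows "x = y"
proof
  fix i
  show "x i = y i"
  proof (cases "i < n - 1")
    case True
    then have "block x (i div 2 + 1) = block y (i div 2 + 1)"
      by (intro eq) auto
    then show ?thesis
      by (cases "even i") (auto simp: block_def elim!: evenE oddE)
  qed (use assms in \<open>auto simp: ambient_def\<close>)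
qed

lemma rot_ambient: "rot n x \<in> ambient n"
  by (simp add: ambient_def rot_def)

lemma antipode_ambient: "x \<in> ambient n \<Longrightarrow> antipode x \<in> ambient n"
  by (simp add: ambient_def antipode_def)

lemma block_antipode: "block (antipode x) t = - block x t"
  by (simp add: block_def antipode_def complex_eq_iff)

lemma block_rot:
  assumes x: "x \<in> ambient n" and t: "1 \<le> t" "2 * t \<le> n"
  shows "block (rot n x) t = unity n (int t) * block x t"
proof (cases "2 * t = n")
  case True
  then have "unity n (int t) = - 1"
    using t by (auto simp: unity_def field_simps complex_eq_iff)
  moreover have "x (n - 1) = 0"
    using x by (simp add: ambientD)
  ultimately show ?thesis
    using True t by (auto simp: block_def rot_def complex_eq_iff Let_def)
next
  case False
  with t have "2 * t < n" by simp
  obtain s where s: "t = Suc s"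
    using t by (cases t) auto
  have ang: "(1 + real s) * (2 * pi / real n) = 2 * pi * (1 + real s) / real n"
    by simp
  have "2 * s \<noteq> n - 2" "even n \<Longrightarrow> Suc (2 * s) \<noteq> n - 2"
    using \<open>2 * t < n\<close> s by (auto elim!: evenE, presburger)
  then show ?thesis
    using \<open>2 * t < n\<close> s
    by (auto simp: block_def rot_def unity_def Let_def complex_eq_iff ang add_ac mult_ac)
qed

lemma rot_power_ambient: "x \<in> ambient n \<Longrightarrow> (rot n ^^ m) x \<in> ambient n"
  using rot_ambient by (cases m) auto

lemma block_rot_power:
  assumes "x \<in> ambient n" "1 \<le> t" "2 * t \<le> n"
  shows "block ((rot n ^^ m) x) t = unity n (int t * int m) * block x t"
proof (induction m)
  case (Suc m)
  have "block ((rot n ^^ Suc m) x) t = unity n (int t) * block ((rot n ^^ m) x) t"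
    using block_rot[OF rot_power_ambient[OF assms(1)] assms(2,3)] by simp
  then show ?case
    by (simp add: Suc distrib_left unity_add mult_ac)
qed simp

lemma rot_order:
  assumes "x \<in> ambient n"
  shows "(rot n ^^ n) x = x"
proof (cases "n = 0")
  case False
  show ?thesis
  proof (rule ambient_eqI[OF rot_power_ambient[OF assms] assms])
    fix t assume "1 \<le> t" "2 * t \<le> n"
    then show "block ((rot n ^^ n) x) t = block x t"
      using block_rot_power[OF assms, of t n] unity_multiple[of n "int t"] False
      by (simp add: mult.commute)
  qed
qed simp

lemma antipode_rot: "antipode (rot n x) = rot n (antipode x)"
  by (auto simp: antipode_def rot_def fun_eq_iff Let_def)

lemma rot_power_antipode: "(rot n ^^ i) (antipode x) = antipode ((rot n ^^ i) x)"
  by (induction i) (auto simp: antipode_rot)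

lemma antipode_antipode [simp]: "antipode (antipode x) = x"
  by (simp add: antipode_def)

lemma sum_squares_block:
  assumes "x \<in> ambient n" "n \<ge> 2"
  shows "(\<Sum>i\<le>n - 2. (x i)\<^sup>2) = (\<Sum>t = 1..n div 2. (cmod (block x t))\<^sup>2)"
proof -
  have "(\<Sum>i<2 * N. (x i)\<^sup>2) = (\<Sum>t = 1..N. (cmod (block x t))\<^sup>2)" for N
    by (induction N) (auto simp: block_def cmod_power2)
  then have "(\<Sum>t = 1..n div 2. (cmod (block x t))\<^sup>2) = (\<Sum>i<2 * (n div 2). (x i)\<^sup>2)"
    by simp
  \<comment> \<open>For odd \<open>n\<close> the two index ranges coincide; for even
    \<open>n\<close> the left one has the extra index \<open>n - 1\<close>, where \<open>x\<close>
    vanishes.\<close>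
  also have "\<dots> = (\<Sum>i\<le>n - 2. (x i)\<^sup>2)"
    by (rule sum.mono_neutral_right) (use assms in \<open>auto intro!: ambientD[of x n]\<close>)
  finally show ?thesis ..
qed

lemma topspace_nsphere_iff:
  assumes "n \<ge> 2"
  shows "x \<in> topspace (nsphere (n - 2)) \<longleftrightarrow>
    x \<in> ambient n \<and> (\<Sum>t = 1..n div 2. (cmod (block x t))\<^sup>2) = 1"
proof -
  have "Suc (n - 2) = n - 1"
    using assms by simp
  then have "x \<in> topspace (nsphere (n - 2)) \<longleftrightarrow> x \<in> ambient n \<and> (\<Sum>i\<le>n - 2. (x i)\<^sup>2) = 1"
    by (auto simp: nsphere_def topspace_Euclidean_space ambient_def)
  then show ?thesis
    using sum_squares_block[of x n] assms by auto
qed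

lemma rot_nsphere:
  assumes "n \<ge> 2" "x \<in> topspace (nsphere (n - 2))"
  shows "rot n x \<in> topspace (nsphere (n - 2))"
proof -
  have "(\<Sum>t = 1..n div 2. (cmod (block (rot n x) t))\<^sup>2) = (\<Sum>t = 1..n div 2. (cmod (block x t))\<^sup>2)"
    using assms by (intro sum.cong) (auto simp: topspace_nsphere_iff block_rot norm_mult)
  then show ?thesis
    using assms rot_ambient by (simp add: topspace_nsphere_iff)
qed

lemma antipode_nsphere:
  "n \<ge> 2 \<Longrightarrow> x \<in> topspace (nsphere (n - 2)) \<Longrightarrow> antipode x \<in> topspace (nsphere (n - 2))"
  by (simp add: topspace_nsphere_iff block_antipode antipode_ambient)

text \<open>The blocks of \<open>x\<close> are extended to a Hermitian family, so that the trigonometric polynomial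
  with these coefficients is real. For even \<open>n\<close> the block \<open>n / 2\<close> has imaginary part
  \<open>x (n - 1) = 0\<close>.\<close>

definition coef :: "nat \<Rightarrow> (nat \<Rightarrow> real) \<Rightarrow> nat \<Rightarrow> complex" where
  "coef n x t = (if t = 0 then 0 else if 2 * t \<le> n then block x t else cnj (block x (n - t)))"

section \<open>Real trigonometric polynomials and Fourier inversion\<close>

definition trig :: "nat \<Rightarrow> (nat \<Rightarrow> real) \<Rightarrow> nat \<Rightarrow> complex" where
  "trig n x m = (\<Sum>t<n. coef n x t * unity n (int t * int m))"

definition dft :: "nat \<Rightarrow> (nat \<Rightarrow> real) \<Rightarrow> nat \<Rightarrow> complex" where
  "dft n y t = (\<Sum>m<n. of_real (y m) * unity n (- (int t * int m))) / of_nat n"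

text \<open>Only the frequencies from 1 to \<open>n div 2\<close> are stored. Higher ones follow by
  Hermitian symmetry, and frequency 0, the mean of \<open>y\<close>, is dropped; this is why
  \<open>trig_of_samples\<close> subtracts the mean.\<close>

definition of_samples :: "nat \<Rightarrow> (nat \<Rightarrow> real) \<Rightarrow> nat \<Rightarrow> real" where
  "of_samples n y = (\<lambda>i. if i \<ge> n - 1 then 0
     else if even i then Re (dft n y (i div 2 + 1)) else Im (dft n y (i div 2 + 1)))"

lemma coef_rot:
  assumes x: "x \<in> ambient n" and "t < n"
  shows "coef n (rot n x) t = unity n (int t) * coef n x t"
proof (cases "2 * t \<le> n")
  case True
  then show ?thesis
    using x by (auto simp: coef_def block_rot)
next
  case False
  then have "block (rot n x) (n - t) = unity n (int (n - t)) * block x (n - t)"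
    using assms by (intro block_rot) auto
  \<comment> \<open>The frequencies \<open>n - t\<close> and \<open>- t\<close> agree modulo
    \<open>n\<close>, and conjugation turns \<open>- t\<close> into \<open>t\<close>.\<close>
  moreover have "cnj (unity n (int (n - t))) = unity n (int t)"
    using assms(2) unity_shift[of n "int t" "- 1"] by (simp add: cnj_unity of_nat_diff)
  ultimately show ?thesis
    using False by (simp add: coef_def)
qed

lemma coef_antipode: "coef n (antipode x) t = - coef n x t"
  by (simp add: coef_def block_antipode)

lemma trig_antipode: "trig n (antipode x) m = - trig n x m"
  by (simp add: trig_def coef_antipode sum_negf)

lemma trig_rot: "x \<in> ambient n \<Longrightarrow> trig n (rot n x) m = trig n x (Suc m)"
  unfolding trig_def
  by (intro sum.cong) (auto simp: coef_rot unity_add distrib_left mult_ac)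

lemma trig_rot_power: "x \<in> ambient n \<Longrightarrow> trig n ((rot n ^^ i) x) m = trig n x (m + i)"
  by (induction i arbitrary: m) (auto simp: trig_rot rot_power_ambient)

lemma trig_mod: "n > 0 \<Longrightarrow> trig n x (m mod n) = trig n x m"
proof -
  assume n: "n > 0"
  have "unity n (int t * int m) = unity n (int t * int (m mod n))" for t
  proof -
    have "int m = int (m mod n) + int n * int (m div n)"
      by (simp flip: of_nat_mult of_nat_add)
    then have "int t * int m = int t * int (m mod n) + int n * (int t * int (m div n))"
      by (simp add: algebra_simps)
    then show ?thesis
      using unity_shift[OF n] by simp
  qed
  then show ?thesis
    by (simp add: trig_def)
qed

text \<open>The case not built into \<open>coef\<close> is the self-paired frequency
  \<open>2 * t = n\<close>, where the symmetry demands a real coefficient.\<close>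

lemma coef_reflect:
  assumes x: "x \<in> ambient n" and t: "1 \<le> t" "t < n"
  shows "coef n x (n - t) = cnj (coef n x t)"
proof -
  have "2 * t = n \<Longrightarrow> x (2 * t - 1) = 0"
    using x by (simp add: ambientD)
  then show ?thesis
    using t by (cases "2 * t = n") (auto simp: coef_def block_def complex_eq_iff)
qed

text \<open>Conjugation exchanges the terms of the frequencies \<open>t\<close> and
  \<open>n - t\<close>.\<close>

lemma trig_real:
  assumes x: "x \<in> ambient n"
  shows "Im (trig n x m) = 0"
proof -
  have eq: "trig n x m = (\<Sum>t\<in>{1..<n}. coef n x t * unity n (int t * int m))"
    unfolding trig_def by (rule sum.mono_neutral_right) (auto simp: coef_def)
  have "cnj (trig n x m) = (\<Sum>t\<in>{1..<n}. cnj (coef n x t) * unity n (- (int t * int m)))"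
    unfolding eq by (simp add: cnj_unity)
  also have "\<dots> = (\<Sum>t\<in>{1..<n}. coef n x t * unity n (int t * int m))"
  proof (rule sum.reindex_bij_witness[of _ "\<lambda>t. n - t" "\<lambda>t. n - t"])
    fix t assume t: "t \<in> {1..<n}"
    then have "unity n (int (n - t) * int m) = unity n (- (int t * int m))"
      using unity_shift[of n "- (int t * int m)" "int m"] by (simp add: of_nat_diff algebra_simps)
    then show "coef n x (n - t) * unity n (int (n - t) * int m)
        = cnj (coef n x t) * unity n (- (int t * int m))"
      using coef_reflect[OF x, of t] t by simp
  qed auto
  finally have "cnj (trig n x m) = trig n x m"
    by (simp add: eq)
  then show ?thesis
    by (simp add: complex_eq_iff)
qed

lemma sum_trig:
  assumes "s < n"
  shows "(\<Sum>m<n. trig n x m * unity n (- (int s * int m))) = of_nat n * coef n x s"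
proof -
  have "(\<Sum>m<n. trig n x m * unity n (- (int s * int m)))
      = (\<Sum>m<n. \<Sum>t<n. coef n x t * unity n ((int t - int s) * int m))"
    unfolding trig_def sum_distrib_right
    by (intro sum.cong refl) (simp add: mult.assoc left_diff_distrib flip: unity_add)
  also have "\<dots> = (\<Sum>t<n. coef n x t * (\<Sum>m<n. unity n ((int t - int s) * int m)))"
    by (subst sum.swap) (simp add: sum_distrib_left)
  \<comment> \<open>Both indices lie below \<open>n\<close>, so \<open>n\<close> divides their
    difference only if they are equal.\<close>
  also have "\<dots> = (\<Sum>t<n. if t = s then of_nat n * coef n x t else 0)"
  proof (rule sum.cong)
    fix t assume "t \<in> {..<n}"
    then have "int n dvd int t - int s \<longleftrightarrow> t = s"
      using assms zdvd_not_zless[of "int t - int s" "int n"] zdvd_not_zless[of "int s - int t" "int n"]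
      by (cases t s rule: linorder_cases) (auto simp: dvd_diff_commute)
    then show "coef n x t * (\<Sum>m<n. unity n ((int t - int s) * int m))
        = (if t = s then of_nat n * coef n x t else 0)"
      using assms by (simp add: sum_unity)
  qed simp
  finally show ?thesis
    using assms by simp
qed

lemma sum_trig_0: "(\<Sum>m<n. trig n x m) = 0"
  using sum_trig[of 0 n x] by (cases "n = 0") (auto simp: coef_def)

lemma trig_inject:
  assumes "x \<in> ambient n" "y \<in> ambient n" "n > 0" and eq: "\<And>m. m < n \<Longrightarrow> trig n x m = trig n y m"
  shows "x = y"
proof (rule ambient_eqI[OF assms(1,2)])
  fix t assume t: "1 \<le> t" "2 * t \<le> n"
  then have "t < n" by simp
  have "(\<Sum>m<n. trig n x m * unity n (- (int t * int m))) = (\<Sum>m<n. trig n y m * unity n (- (int t * int m)))"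
    by (intro sum.cong) (auto simp: eq)
  then have "coef n x t = coef n y t"
    using \<open>t < n\<close> by (simp add: sum_trig)
  then show "block x t = block y t"
    using t by (simp add: coef_def)
qed

lemma of_samples_ambient: "of_samples n y \<in> ambient n"
  by (simp add: ambient_def of_samples_def)

lemma dft_reflect:
  assumes "t < n"
  shows "dft n y (n - t) = cnj (dft n y t)"
proof -
  have "unity n (- (int (n - t) * int m)) = unity n (int t * int m)" for m
    using unity_shift[of n "int t * int m" "- int m"] assms by (simp add: of_nat_diff algebra_simps)
  then show ?thesis
    by (simp add: dft_def cnj_unity)
qed

lemma block_of_samples:
  assumes t: "1 \<le> t" "2 * t \<le> n"
  shows "block (of_samples n y) t = dft n y t"
proof -
  obtain s where s: "t = Suc s"
    using t by (cases t) auto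
  \<comment> \<open>The self-paired frequency has a single real coordinate to hold it, so its
    transform must be real.\<close>
  have "Im (dft n y t) = 0" if "2 * t = n"
  proof -
    have "cnj (dft n y t) = dft n y t"
      using dft_reflect[of t n y] that t by (metis add_diff_cancel_right' mult_2 diff_add_inverse less_add_same_cancel1 not_gr_zero not_one_le_zero)
    then show ?thesis
      by (simp add: complex_eq_iff)
  qed
  then show ?thesis
    using t s by (auto simp: block_def of_samples_def complex_eq_iff)
qed

lemma coef_of_samples:
  assumes t: "1 \<le> t" "t < n"
  shows "coef n (of_samples n y) t = dft n y t"
proof (cases "2 * t \<le> n")
  case False
  then have "block (of_samples n y) (n - t) = dft n y (n - t)"
    using t by (intro block_of_samples) auto
  then show ?thesis
    using t False by (simp add: coef_def dft_reflect)
qed (use t in \<open>simp add: coef_def block_of_samples\<close>)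

lemma sum_dft:
  assumes "m < n"
  shows "(\<Sum>t<n. dft n y t * unity n (int t * int m)) = of_real (y m)"
proof -
  have mult: "unity n (- (int t * int i)) * unity n (int t * int m) = unity n ((int m - int i) * int t)"
    for t i
    by (simp add: algebra_simps flip: unity_add)
  have "(\<Sum>t<n. dft n y t * unity n (int t * int m))
      = (\<Sum>t<n. \<Sum>i<n. of_real (y i) * unity n ((int m - int i) * int t)) / of_nat n"
    unfolding dft_def sum_distrib_right sum_divide_distrib
    by (intro sum.cong refl) (simp flip: mult)
  also have "\<dots> = (\<Sum>i<n. of_real (y i) * (\<Sum>t<n. unity n ((int m - int i) * int t))) / of_nat n"
    by (subst sum.swap) (simp add: sum_distrib_left)
  also have "(\<Sum>i<n. of_real (y i) * (\<Sum>t<n. unity n ((int m - int i) * int t)))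
      = (\<Sum>i<n. if i = m then of_nat n * of_real (y i) else 0)"
  proof (rule sum.cong)
    fix i assume "i \<in> {..<n}"
    then have "int n dvd int m - int i \<longleftrightarrow> i = m"
      using assms zdvd_not_zless[of "int m - int i" "int n"] zdvd_not_zless[of "int i - int m" "int n"]
      by (cases i m rule: linorder_cases) (auto simp: dvd_diff_commute)
    then show "of_real (y i) * (\<Sum>t<n. unity n ((int m - int i) * int t))
        = (if i = m then of_nat n * of_real (y i) else 0)"
      using assms by (simp add: sum_unity)
  qed simp
  finally show ?thesis
    using assms by simp
qed

lemma trig_of_samples:
  assumes "m < n"
  shows "trig n (of_samples n y) m = of_real (y m - (\<Sum>i<n. y i) / real n)"
proof -
  have eq: "{..<n} = insert 0 {1..<n}"
    using assms by auto
  have "trig n (of_samples n y) m = (\<Sum>t\<in>{1..<n}. coef n (of_samples n y) t * unity n (int t * int m))"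
    unfolding trig_def by (rule sum.mono_neutral_right) (auto simp: coef_def)
  also have "\<dots> = (\<Sum>t\<in>{1..<n}. dft n y t * unity n (int t * int m))"
    by (intro sum.cong) (auto simp: coef_of_samples)
  also have "\<dots> = of_real (y m) - dft n y 0"
    using sum_dft[OF assms, of y] unfolding eq by (simp add: algebra_simps)
  finally show ?thesis
    by (simp add: dft_def)
qed

section \<open>The shapes\<close>

text \<open>In terms of limits the rules \<open>tendsto_intros\<close> prove continuity on abstract
  topologies such as \<open>complex_space m\<close>.\<close>

lemma continuous_map_euclidean_tendsto:
  "continuous_map X euclidean f \<longleftrightarrow> (\<forall>x\<in>topspace X. (f \<longlongrightarrow> f x) (atin X x))"
  by (simp add: continuous_map_atin limitin_canonical_iff)

lemma continuous_map_nsphere_euclidean: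
  assumes "continuous_on UNIV h"
  shows "continuous_map (nsphere p) euclidean h"
proof -
  have "continuous_map (powertop_real UNIV) euclidean h"
    using assms by (metis continuous_map_iff_continuous2 euclidean_product_topology subtopology_UNIV)
  then show ?thesis
    unfolding nsphere by (rule continuous_map_from_subtopology)
qed

lemma topspace_complex_space: "topspace (complex_space m) = extensional {..<m}"
  by (simp add: complex_space_def PiE_def)

lemma continuous_map_complex_space:
  "continuous_map X (complex_space m) h \<longleftrightarrow>
    h \<in> topspace X \<rightarrow> extensional {..<m} \<and> (\<forall>i<m. continuous_map X euclidean (\<lambda>x. h x i))"
  by (auto simp: complex_space_def continuous_map_componentwise)

lemma continuous_map_complex_space_coordinate:
  "i < m \<Longrightarrow> continuous_map (complex_space m) euclidean (\<lambda>z. z i)"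
  unfolding complex_space_def by (rule continuous_map_product_projection) simp

text \<open>The two inclusions compose with the affine map and with its inverse. The relation is
  required only below \<open>m\<close>, so functions that differ elsewhere can be compared.\<close>

lemma affine_class_affine:
  assumes "\<alpha> \<noteq> 0" and w: "\<And>i. i < m \<Longrightarrow> w i = \<alpha> * z i + \<beta>"
  shows "affine_class m w = affine_class m z"
proof
  show "affine_class m w \<subseteq> affine_class m z"
  proof
    fix v assume "v \<in> affine_class m w"
    then obtain a b where v: "v = (\<lambda>i\<in>{..<m}. a * w i + b)" and "a \<noteq> 0"
      by (auto simp: affine_class_def)
    have "v = (\<lambda>i\<in>{..<m}. (a * \<alpha>) * z i + (a * \<beta> + b))"
      unfolding v by (auto simp: w algebra_simps restrict_def)
    moreover have "a * \<alpha> \<noteq> 0"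
      using \<open>a \<noteq> 0\<close> \<open>\<alpha> \<noteq> 0\<close> by simp
    ultimately show "v \<in> affine_class m z"
      unfolding affine_class_def by blast
  qed
  show "affine_class m z \<subseteq> affine_class m w"
  proof
    fix v assume "v \<in> affine_class m z"
    then obtain a b where v: "v = (\<lambda>i\<in>{..<m}. a * z i + b)" and "a \<noteq> 0"
      by (auto simp: affine_class_def)
    have "v = (\<lambda>i\<in>{..<m}. (a / \<alpha>) * w i + (b - a * \<beta> / \<alpha>))"
      unfolding v using \<open>\<alpha> \<noteq> 0\<close> by (auto simp: w field_simps restrict_def)
    moreover have "a / \<alpha> \<noteq> 0"
      using \<open>a \<noteq> 0\<close> \<open>\<alpha> \<noteq> 0\<close> by simp
    ultimately show "v \<in> affine_class m w"
      unfolding affine_class_def by blast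
  qed
qed

lemma affine_class_self: "z \<in> extensional {..<m} \<Longrightarrow> z \<in> affine_class m z"
proof -
  assume "z \<in> extensional {..<m}"
  then have "z = (\<lambda>i\<in>{..<m}. 1 * z i + 0)"
    by (simp add: extensional_restrict)
  then show ?thesis
    unfolding affine_class_def by (intro CollectI exI[of _ 1] exI[of _ 0] conjI) simp_all
qed

lemma affine_class_eqD:
  assumes "affine_class m w = affine_class m z" "w \<in> extensional {..<m}"
  obtains a b where "a \<noteq> 0" "\<And>i. i < m \<Longrightarrow> w i = a * z i + b"
proof -
  have "w \<in> affine_class m z"
    using affine_class_self assms by blast
  then show thesis
    using that by (force simp: affine_class_def)
qed

definition configs :: "nat \<Rightarrow> (nat \<Rightarrow> complex) set" where
  "configs m = extensional {..<m} - diagonal m"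

lemma shape_space_eq:
  "shape_space m = quotient_topology (subtopology (complex_space m) (configs m)) (affine_class m)"
  by (simp add: shape_space_def configs_def topspace_complex_space)

lemma topspace_configs: "topspace (subtopology (complex_space m) (configs m)) = configs m"
  by (auto simp: topspace_complex_space configs_def)

lemma topspace_shape_space: "topspace (shape_space m) = affine_class m ` configs m"
  unfolding shape_space_eq topspace_quotient_topology topspace_configs ..

lemma diagonal_iff: "z \<in> extensional {..<m} \<Longrightarrow> z \<in> diagonal m \<longleftrightarrow> (\<exists>b. \<forall>i<m. z i = b)"
  by (auto simp: diagonal_def extensional_def fun_eq_iff)

lemma configs_affine:
  assumes "z \<in> configs m" "a \<noteq> 0"
  shows "(\<lambda>i\<in>{..<m}. a * z i + b) \<in> configs m"
proof -
  have "\<exists>i<m. a * z i + b \<noteq> c" if nc: "\<forall>c. \<exists>i<m. z i \<noteq> c" for c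
  proof -
    obtain i where "i < m" "z i \<noteq> (c - b) / a"
      using nc by blast
    then show ?thesis
      using \<open>a \<noteq> 0\<close> by (auto simp: field_simps)
  qed
  then show ?thesis
    using assms by (auto simp: configs_def diagonal_iff)
qed

lemma continuous_map_affine:
  "continuous_map (complex_space m) (complex_space m) (\<lambda>z. \<lambda>i\<in>{..<m}. a * z i + b)"
  unfolding continuous_map_complex_space
proof (intro conjI allI impI)
  fix i assume "i < m"
  then have "continuous_map (complex_space m) euclidean (\<lambda>z. a * z i + b)"
    using continuous_map_complex_space_coordinate[of i m]
    unfolding continuous_map_euclidean_tendsto by (auto intro!: tendsto_intros)
  then show "continuous_map (complex_space m) euclidean (\<lambda>z. (\<lambda>i\<in>{..<m}. a * z i + b) i)"
    using \<open>i < m\<close> by simp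
qed auto

text \<open>The saturation of an open set is the union of its preimages under all affine bijections,
  hence open. Openness is wanted because it survives restriction to the saturated set of collinear
  configurations, whereas a bare quotient map need not remain one there.\<close>

lemma open_map_affine_class:
  "open_map (subtopology (complex_space m) (configs m)) (shape_space m) (affine_class m)"
  unfolding open_map_def
proof (intro allI impI)
  let ?X = "subtopology (complex_space m) (configs m)"
  fix U assume U: "openin ?X U"
  then have sub: "U \<subseteq> configs m"
    using openin_subset topspace_configs by blast
  have "{z \<in> topspace ?X. affine_class m z \<in> affine_class m ` U} =
      (\<Union>a\<in>-{0}. \<Union>b. {z \<in> topspace ?X. (\<lambda>i\<in>{..<m}. a * z i + b) \<in> U})" (is "?L = ?R")
  proof
    show "?L \<subseteq> ?R"
    proof
      fix z assume "z \<in> ?L"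
      then obtain u where z: "z \<in> topspace ?X" "u \<in> U" "affine_class m u = affine_class m z"
        by auto
      have ext: "u \<in> extensional {..<m}"
        using z(2) sub by (auto simp: configs_def)
      obtain a b where ab: "a \<noteq> 0" "\<And>i. i < m \<Longrightarrow> u i = a * z i + b"
        using affine_class_eqD[OF z(3) ext] by blast
      then have "u = (\<lambda>i\<in>{..<m}. a * z i + b)"
        using ext by (auto simp: fun_eq_iff extensional_def)
      then show "z \<in> ?R"
        using z ab by blast
    qed
    show "?R \<subseteq> ?L"
    proof
      fix z assume "z \<in> ?R"
      then obtain a b where "a \<noteq> 0" and z: "z \<in> topspace ?X" "(\<lambda>i\<in>{..<m}. a * z i + b) \<in> U"
        by blast
      then have "affine_class m (\<lambda>i\<in>{..<m}. a * z i + b) = affine_class m z"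
        by (intro affine_class_affine) auto
      then show "z \<in> ?L"
        using z by (metis (mono_tags, lifting) imageI mem_Collect_eq)
    qed
  qed
  moreover have "openin ?X {z \<in> topspace ?X. (\<lambda>i\<in>{..<m}. a * z i + b) \<in> U}" if "a \<noteq> 0" for a b
  proof (rule openin_continuous_map_preimage[OF _ U])
    have "continuous_map ?X (complex_space m) (\<lambda>z. \<lambda>i\<in>{..<m}. a * z i + b)"
      by (intro continuous_map_from_subtopology continuous_map_affine)
    moreover have "(\<lambda>z. \<lambda>i\<in>{..<m}. a * z i + b) \<in> configs m \<rightarrow> configs m"
      using configs_affine that by blast
    ultimately show "continuous_map ?X ?X (\<lambda>z. \<lambda>i\<in>{..<m}. a * z i + b)"
      unfolding continuous_map_in_subtopology topspace_configs by auto
  qed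
  then have "openin ?X ?R" by blast
  ultimately show "openin (shape_space m) (affine_class m ` U)"
    using sub image_mono[of U "topspace ?X" "affine_class m"]
    unfolding shape_space_eq openin_quotient_topology topspace_configs by simp
qed

section \<open>Collinear configurations and their cyclic orbits\<close>

lemma collinear_configs_eq: "collinear_configs m = {z \<in> configs m. collinear (z ` {..<m})}"
  by (auto simp: collinear_configs_def configs_def topspace_complex_space)

lemma collinear_real_coordinates:
  fixes z :: "nat \<Rightarrow> complex"
  assumes "collinear (z ` {..<m})"
  obtains a b y where "a \<noteq> (0::complex)" "\<And>i. i < m \<Longrightarrow> z i = a * of_real (y i) + b"
proof -
  obtain u where u: "\<forall>x\<in>z ` {..<m}. \<forall>y\<in>z ` {..<m}. \<exists>c. x - y = c *\<^sub>R u"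
    using assms by (auto simp: collinear_def)
  show thesis
  proof (cases "u = 0")
    \<comment> \<open>All points coincide; as \<open>a\<close> must be nonzero, direction 1 is taken
      with all real coordinates zero.\<close>
    case True
    have z0: "z i = 1 * of_real 0 + z 0" if "i < m" for i
    proof -
      have "z i \<in> z ` {..<m}" "z 0 \<in> z ` {..<m}"
        using that by auto
      then obtain c where "z i - z 0 = c *\<^sub>R u"
        using u by blast
      then show ?thesis
        using True by simp
    qed
    show thesis
      by (rule that[OF one_neq_zero z0])
  next
    case False
    have "\<forall>i\<in>{..<m}. \<exists>c. z i - z 0 = c *\<^sub>R u"
    proof
      fix i assume "i \<in> {..<m}"
      then have "z i \<in> z ` {..<m}" "z 0 \<in> z ` {..<m}"
        by auto
      then show "\<exists>c. z i - z 0 = c *\<^sub>R u"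
        using u by blast
    qed
    then obtain y where y: "\<forall>i\<in>{..<m}. z i - z 0 = y i *\<^sub>R u"
      by metis
    have "z i = u * of_real (y i) + z 0" if "i < m" for i
    proof -
      have "z i = (z i - z 0) + z 0"
        by simp
      also have "z i - z 0 = u * of_real (y i)"
        using bspec[OF y, of i] that by (simp only: lessThan_iff scaleR_conv_of_real mult.commute)
      finally show ?thesis .
    qed
    with False show thesis
      by (intro that)
  qed
qed

lemma collinear_affine:
  fixes z w :: "nat \<Rightarrow> complex"
  assumes w: "\<And>i. i < m \<Longrightarrow> w i = a * z i + (b::complex)" and "collinear (z ` {..<m})"
  shows "collinear (w ` {..<m})"
proof -
  obtain u where u: "\<forall>x\<in>z ` {..<m}. \<forall>y\<in>z ` {..<m}. \<exists>c. x - y = c *\<^sub>R u"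
    using assms(2) by (auto simp: collinear_def)
  have "\<exists>c. w i - w i' = c *\<^sub>R (a * u)" if i: "i < m" "i' < m" for i i'
  proof -
    obtain c where "z i - z i' = c *\<^sub>R u"
      using u i by auto
    moreover have "w i - w i' = a * (z i - z i')"
      using i by (simp add: w algebra_simps)
    ultimately show ?thesis
      by auto
  qed
  then show ?thesis
    unfolding collinear_def by (intro exI[of _ "a * u"]) auto
qed

text \<open>The composite of the two projections onto \<open>linear_shapes m\<close>, so that
  configurations rather than their affine classes serve as representatives.\<close>

definition shape_orbit :: "nat \<Rightarrow> (nat \<Rightarrow> complex) \<Rightarrow> (nat \<Rightarrow> complex) set set" where
  "shape_orbit m z = generated_orbit (topspace (shape_space m)) {shape_shift m} (affine_class m z)"

text \<open>Collinearity is invariant under affine maps, so the collinear configurations are a full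
  preimage and the open map onto affine classes restricts to them.\<close>

lemma quotient_map_shape_orbit:
  "quotient_map (subtopology (complex_space m) (collinear_configs m)) (linear_shapes m) (shape_orbit m)"
proof -
  let ?X = "subtopology (complex_space m) (configs m)" and ?C = "collinear_configs m"
  let ?L = "affine_class m ` ?C"
  have sat: "{z \<in> topspace ?X. affine_class m z \<in> ?L} = ?C"
  proof -
    have "z \<in> ?C" if z: "z \<in> configs m" "w \<in> ?C" "affine_class m z = affine_class m w" for z w
    proof -
      obtain a b where "\<And>i. i < m \<Longrightarrow> z i = a * w i + b"
        using affine_class_eqD[OF z(3)] z(1) by (metis DiffD1 configs_def)
      then show ?thesis
        using z collinear_affine[of m z a w b] by (auto simp: collinear_configs_eq)
    qed
    then show ?thesis
      unfolding topspace_configs by (auto simp: collinear_configs_eq)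
  qed
  have "open_map (subtopology ?X ?C) (subtopology (shape_space m) ?L) (affine_class m)"
    by (rule open_map_restriction[OF open_map_affine_class sat])
  moreover have "continuous_map (subtopology ?X ?C) (subtopology (shape_space m) ?L) (affine_class m)"
  proof -
    have "continuous_map ?X (shape_space m) (affine_class m)"
      unfolding shape_space_eq by (intro quotient_imp_continuous_map quotient_map_quotient_topology)
    then show ?thesis
      by (auto simp: continuous_map_in_subtopology continuous_map_from_subtopology)
  qed
  moreover have "affine_class m ` topspace (subtopology ?X ?C) = topspace (subtopology (shape_space m) ?L)"
  proof -
    have "topspace (subtopology ?X ?C) = ?C"
      using sat by (auto simp: topspace_complex_space configs_def)
    moreover have "topspace (subtopology (shape_space m) ?L) = ?L"
      by (auto simp: topspace_shape_space collinear_configs_eq)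
    ultimately show ?thesis by simp
  qed
  ultimately have "quotient_map (subtopology ?X ?C) (subtopology (shape_space m) ?L) (affine_class m)"
    by (intro continuous_open_imp_quotient_map)
  moreover have "subtopology ?X ?C = subtopology (complex_space m) ?C"
    by (auto simp: subtopology_subtopology collinear_configs_eq intro!: arg_cong2[of _ _ _ _ subtopology])
  moreover have "quotient_map (subtopology (shape_space m) ?L) (linear_shapes m)
      (generated_orbit (topspace (shape_space m)) {shape_shift m})"
    unfolding linear_shapes_def orbit_space_def by (rule quotient_map_quotient_topology)
  ultimately show ?thesis
    using quotient_map_compose unfolding shape_orbit_def comp_def by fastforce
qed

lemma cyclic_shift_power:
  assumes "m > 0"
  shows "i < m \<Longrightarrow> (cyclic_shift m ^^ l) z i = z ((i + l) mod m)"
proof (induction l arbitrary: i)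
  case (Suc l)
  then show ?case
    using assms by (simp add: cyclic_shift_def mod_add_left_eq)
qed simp

lemma shape_shift_power:
  "(shape_shift m ^^ l) (affine_class m z) = affine_class m ((cyclic_shift m ^^ l) z)"
  by (induction l) (auto simp: shape_shift_affine_class)

lemma cyclic_shift_configs:
  assumes "z \<in> configs m"
  shows "cyclic_shift m z \<in> configs m"
proof -
  have shift: "\<exists>c. \<forall>i<m. z i = c" if c: "\<forall>i<m. z (Suc i mod m) = c" for c
  proof -
    have "z i = c" if "i < m" for i
    proof (cases i)
      case 0
      with that have "m - 1 < m" "Suc (m - 1) mod m = 0" by auto
      then show ?thesis using c 0 by metis
    next
      case (Suc i')
      with that c show ?thesis by (metis Suc_lessD mod_less)
    qed
    then show ?thesis by blast
  qed
  have "\<not> (\<exists>c. \<forall>i<m. z i = c)"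
    using assms diagonal_iff[of z m] unfolding configs_def by blast
  then have "\<not> (\<exists>c. \<forall>i<m. z (Suc i mod m) = c)"
    using shift by blast
  then show ?thesis
    by (simp add: configs_def diagonal_iff cyclic_shift_def)
qed

lemma commuting_maps_shape_shift:
  assumes "m > 0"
  shows "commuting_maps (topspace (shape_space m)) (shape_shift m) (shape_shift m) m m"
proof
  fix c assume c: "c \<in> topspace (shape_space m)"
  then obtain z where z: "z \<in> configs m" "c = affine_class m z"
    by (auto simp: topspace_shape_space)
  show "shape_shift m c \<in> topspace (shape_space m)"
    using z cyclic_shift_configs by (auto simp: topspace_shape_space shape_shift_affine_class)
  have "affine_class m ((cyclic_shift m ^^ m) z) = affine_class m z"
    by (rule affine_class_affine[where \<alpha> = 1 and \<beta> = 0]) (auto simp: cyclic_shift_power assms)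
  then show "(shape_shift m ^^ m) c = c"
    by (simp add: z shape_shift_power)
qed (use assms in auto)

lemma shape_orbit_eq_iff:
  assumes "m > 0" "z \<in> configs m" "w \<in> configs m"
  shows "shape_orbit m z = shape_orbit m w \<longleftrightarrow> (\<exists>i. affine_class m w = affine_class m ((cyclic_shift m ^^ i) z))"
proof -
  interpret commuting_maps "topspace (shape_space m)" "shape_shift m" "shape_shift m" m m
    by (rule commuting_maps_shape_shift[OF assms(1)])
  have "shape_orbit m z = shape_orbit m w \<longleftrightarrow>
      (\<exists>i l. affine_class m w = (shape_shift m ^^ i) ((shape_shift m ^^ l) (affine_class m z)))"
    using generated_orbit_eq_iff[of "affine_class m z" "affine_class m w"] assms
    by (simp add: shape_orbit_def topspace_shape_space)
  also have "\<dots> \<longleftrightarrow> (\<exists>i. affine_class m w = (shape_shift m ^^ i) (affine_class m z))"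
    by (metis add.right_neutral comp_apply funpow_add)
  finally show ?thesis
    by (simp add: shape_shift_power)
qed

section \<open>The fixed sphere of the \<open>j\<close>-th power\<close>

lemma commuting_maps_rot_antipode:
  assumes "n \<ge> 2"
  shows "commuting_maps (topspace (nsphere (n - 2))) (rot n) antipode n 2"
proof
  fix x assume x: "x \<in> topspace (nsphere (n - 2))"
  show "rot n x \<in> topspace (nsphere (n - 2))" "antipode x \<in> topspace (nsphere (n - 2))"
    using rot_nsphere antipode_nsphere assms x by blast+
  show "(rot n ^^ n) x = x"
    using x assms by (simp add: rot_order topspace_nsphere_iff)
  show "(antipode ^^ 2) x = x"
    by (simp add: numeral_2_eq_2)
  show "rot n (antipode x) = antipode (rot n x)"
    by (simp add: antipode_rot)
qed (use assms in auto)

definition orbit :: "nat \<Rightarrow> (nat \<Rightarrow> real) \<Rightarrow> (nat \<Rightarrow> real) set" where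
  "orbit n = generated_orbit (topspace (nsphere (n - 2))) {rot n, antipode}"

lemma orbit_eq_iff:
  assumes "n \<ge> 2" "x \<in> topspace (nsphere (n - 2))" "y \<in> topspace (nsphere (n - 2))"
  shows "orbit n x = orbit n y \<longleftrightarrow> (\<exists>i. y = (rot n ^^ i) x \<or> y = antipode ((rot n ^^ i) x))"
proof -
  interpret commuting_maps "topspace (nsphere (n - 2))" "rot n" antipode n 2
    by (rule commuting_maps_rot_antipode[OF assms(1)])
  have a: "(antipode ^^ l) z = z \<or> (antipode ^^ l) z = antipode z" for l z
    by (induction l) auto
  have "(\<exists>i l. y = (rot n ^^ i) ((antipode ^^ l) x)) \<longleftrightarrow>
      (\<exists>i. y = (rot n ^^ i) x \<or> y = antipode ((rot n ^^ i) x))"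
  proof
    assume "\<exists>i l. y = (rot n ^^ i) ((antipode ^^ l) x)"
    then show "\<exists>i. y = (rot n ^^ i) x \<or> y = antipode ((rot n ^^ i) x)"
      using a rot_power_antipode by metis
  next
    assume "\<exists>i. y = (rot n ^^ i) x \<or> y = antipode ((rot n ^^ i) x)"
    then obtain i where "y = (rot n ^^ i) ((antipode ^^ 0) x) \<or> y = (rot n ^^ i) ((antipode ^^ 1) x)"
      by (auto simp: rot_power_antipode)
    then show "\<exists>i l. y = (rot n ^^ i) ((antipode ^^ l) x)"
      by blast
  qed
  then show ?thesis
    unfolding orbit_def generated_orbit_eq_iff[OF assms(2,3)] .
qed

section \<open>Continuity of the samples and of the group action\<close>

lemma continuous_on_block: "continuous_on UNIV (\<lambda>x. block x t)"
  unfolding block_def Complex_eq by (intro continuous_intros continuous_on_product_coordinates)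

lemma continuous_on_trig: "continuous_on UNIV (\<lambda>x. trig n x m)"
proof -
  have "continuous_on UNIV (\<lambda>x. coef n x t)" for t
    using continuous_on_block by (cases "t = 0"; cases "2 * t \<le> n")
      (auto simp: coef_def[abs_def] intro!: continuous_intros)
  then show ?thesis
    unfolding trig_def by (intro continuous_intros)
qed

lemma continuous_map_into_nsphere:
  assumes "\<And>i. continuous_map X euclideanreal (\<lambda>x. f x i)"
    and "\<And>x. x \<in> topspace X \<Longrightarrow> f x \<in> topspace (nsphere p)"
  shows "continuous_map X (nsphere p) f"
proof -
  have "continuous_map X (powertop_real UNIV) f"
    using assms(1) by (simp add: continuous_map_componentwise_UNIV)
  then show ?thesis
    using assms(2) unfolding nsphere by (auto simp: continuous_map_in_subtopology)
qed

text \<open>The condition is independent of the point, as are the case distinctions in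
  \<open>rot\<close>, which concern only the coordinate index.\<close>

lemma continuous_on_if_const:
  assumes "P \<Longrightarrow> continuous_on S f" "\<not> P \<Longrightarrow> continuous_on S g"
  shows "continuous_on S (\<lambda>x. if P then f x else g x)"
  using assms by (cases P) auto

lemma continuous_map_rot:
  assumes "n \<ge> 2"
  shows "continuous_map (nsphere (n - 2)) (nsphere (n - 2)) (rot n)"
proof (rule continuous_map_into_nsphere)
  fix i
  have "continuous_on UNIV (\<lambda>x. rot n x i)"
    unfolding rot_def Let_def
    by (intro continuous_on_if_const continuous_intros continuous_on_product_coordinates)
  then show "continuous_map (nsphere (n - 2)) euclideanreal (\<lambda>x. rot n x i)"
    by (rule continuous_map_nsphere_euclidean)
qed (use assms rot_nsphere in blast)

lemma continuous_map_antipode: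
  assumes "n \<ge> 2"
  shows "continuous_map (nsphere (n - 2)) (nsphere (n - 2)) antipode"
proof (rule continuous_map_into_nsphere)
  fix i
  have "continuous_on UNIV (\<lambda>x. antipode x i)"
    unfolding antipode_def by (intro continuous_intros continuous_on_product_coordinates)
  then show "continuous_map (nsphere (n - 2)) euclideanreal (\<lambda>x. antipode x i)"
    by (rule continuous_map_nsphere_euclidean)
qed (use assms antipode_nsphere in blast)

section \<open>Fixed points as periodic sequences\<close>

lemma rot_power_fixed_iff:
  assumes "x \<in> ambient n" "n > 0"
  shows "(rot n ^^ j) x = x \<longleftrightarrow> (\<forall>m. trig n x (m + j) = trig n x m)"
proof
  assume "\<forall>m. trig n x (m + j) = trig n x m"
  then show "(rot n ^^ j) x = x"
    using assms by (intro trig_inject[of _ n]) (auto simp: rot_power_ambient trig_rot_power)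
qed (use assms trig_rot_power in metis)

lemma trig_mod_period:
  assumes "x \<in> ambient n" "n > 0" "(rot n ^^ j) x = x"
  shows "trig n x (m mod j) = trig n x m"
proof (induction m rule: less_induct)
  case (less m)
  have per: "trig n x (i + j) = trig n x i" for i
    using rot_power_fixed_iff assms by blast
  show ?case
  proof (cases "j = 0 \<or> m < j")
    case False
    then have "trig n x ((m - j) mod j) = trig n x (m - j)"
      by (intro less) auto
    then show ?thesis
      using False per[of "m - j"] by (simp add: le_mod_geq)
  qed auto
qed

lemma trig_scale: "trig n (\<lambda>i. r * x i) m = of_real r * trig n x m"
proof -
  have "coef n (\<lambda>i. r * x i) t = of_real r * coef n x t" for t
    by (auto simp: coef_def block_def complex_eq_iff)
  then show ?thesis
    by (simp add: trig_def sum_distrib_left mult.assoc)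
qed

text \<open>The samples sum to zero over \<open>n\<close> indices, which forces a constant value to
  vanish.\<close>

lemma trig_const_zero:
  assumes "x \<in> ambient n" "n > 0" "\<And>m. trig n x m = b"
  shows "x = (\<lambda>_. 0)"
proof (rule trig_inject[OF assms(1)])
  have "of_nat n * b = 0"
    using sum_trig_0[of n x] assms(3) by simp
  then show "trig n x m = trig n (\<lambda>_. 0) m" for m
    using assms(2,3) trig_scale[of n 0 x m] by simp
qed (use assms in \<open>auto simp: ambient_def\<close>)

definition samples :: "nat \<Rightarrow> nat \<Rightarrow> (nat \<Rightarrow> real) \<Rightarrow> nat \<Rightarrow> complex" where
  "samples n j x = (\<lambda>m\<in>{..<j}. trig n x m)"

lemma nsphere_nonzero: "(\<lambda>_. 0) \<notin> topspace (nsphere p)"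
  by (simp add: nsphere_def)

locale fixed_sphere =
  fixes n j :: nat
  assumes n: "n \<ge> 2" and j: "j dvd n"
begin

lemma n_pos: "n > 0" and j_pos: "j > 0"
  using n j by (auto intro: Nat.gr0I)

lemma ell_plusD:
  assumes "x \<in> ell_plus j n"
  shows "x \<in> topspace (nsphere (n - 2))" "x \<in> ambient n" "(rot n ^^ j) x = x"
    "trig n x m = trig n x (m mod j)"
  using assms n trig_mod_period[of x n j m] n_pos by (auto simp: ell_plus_def topspace_nsphere_iff)

lemma topspace_ell_plus: "topspace (subtopology (nsphere (n - 2)) (ell_plus j n)) = ell_plus j n"
  by (auto simp: ell_plus_def)

text \<open>Samples constant over one period are constant throughout, and a constant sequence of
  mean zero comes from the origin, which is not on the sphere.\<close>

lemma samples_configs: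
  assumes x: "x \<in> ell_plus j n"
  shows "samples n j x \<in> configs j"
proof -
  have False if b: "\<forall>m<j. trig n x m = b" for b
  proof -
    have "trig n x m = b" for m
      using b ell_plusD(4)[OF x, of m] j_pos by simp
    then have "x = (\<lambda>_. 0)"
      using ell_plusD(2)[OF x] n_pos trig_const_zero by blast
    then show False
      using ell_plusD(1)[OF x] nsphere_nonzero by simp
  qed
  then show ?thesis
    by (auto simp: samples_def configs_def diagonal_iff)
qed

lemma samples_collinear:
  assumes x: "x \<in> ell_plus j n"
  shows "samples n j x \<in> collinear_configs j"
proof -
  have "u - v = Re (u - v) *\<^sub>R 1" if "u \<in> samples n j x ` {..<j}" "v \<in> samples n j x ` {..<j}" for u v
    using that trig_real[OF ell_plusD(2)[OF x]] by (auto simp: samples_def complex_eq_iff)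
  then have "collinear (samples n j x ` {..<j})"
    unfolding collinear_def by blast
  then show ?thesis
    using samples_configs[OF x] by (simp add: collinear_configs_eq)
qed

lemma samples_rot_power:
  assumes x: "x \<in> ell_plus j n" and "m < j"
  shows "(cyclic_shift j ^^ i) (samples n j x) m = samples n j ((rot n ^^ i) x) m"
  using assms j_pos ell_plusD(4)[OF x, of "m + i"] trig_rot_power[OF ell_plusD(2)[OF x], of i m]
  by (simp add: cyclic_shift_power samples_def)

lemma rot_ell_plus:
  assumes "x \<in> ell_plus j n"
  shows "rot n x \<in> ell_plus j n"
  using assms n rot_nsphere funpow_swap1[of "rot n" j x] by (simp add: ell_plus_def)

lemma antipode_ell_plus:
  assumes x: "x \<in> ell_plus j n"
  shows "antipode x \<in> ell_plus j n"
proof -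
  have "(rot n ^^ j) (antipode x) = antipode x"
    using rot_power_fixed_iff ell_plusD[OF x] n_pos
    by (simp add: antipode_ambient trig_antipode)
  then show ?thesis
    using x n antipode_nsphere by (simp add: ell_plus_def)
qed

lemma rot_power_ell_plus: "x \<in> ell_plus j n \<Longrightarrow> (rot n ^^ i) x \<in> ell_plus j n"
  by (induction i) (auto simp: rot_ell_plus)

text \<open>The samples have sum zero over a period and are real, so that an affine relation between
  them is multiplication by a real number.\<close>

lemma affine_class_samples_eqD:
  assumes u: "u \<in> ell_plus j n" and v: "v \<in> ell_plus j n"
    and eq: "affine_class j (samples n j u) = affine_class j (samples n j v)"
  shows "u = v \<or> u = antipode v"
proof -
  obtain a b where ab: "a \<noteq> 0" "\<And>m. m < j \<Longrightarrow> samples n j u m = a * samples n j v m + b"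
    using affine_class_eqD[OF eq] by (auto simp: samples_def)
  have uv: "trig n u m = a * trig n v m + b" for m
    using ab(2)[of "m mod j"] j_pos ell_plusD(4)[OF u, of m] ell_plusD(4)[OF v, of m]
    by (simp add: samples_def)
  have "(\<Sum>m<n. trig n u m) = a * (\<Sum>m<n. trig n v m) + of_nat n * b"
    by (simp add: uv sum.distrib sum_distrib_left)
  then have "b = 0"
    using n_pos by (simp add: sum_trig_0)
  obtain m where m: "trig n v m \<noteq> 0"
    using trig_const_zero[of v n 0] ell_plusD(1,2)[OF v] n_pos nsphere_nonzero by metis
  have "a = trig n u m / trig n v m"
    using m uv[of m] \<open>b = 0\<close> by simp
  moreover have "trig n u m = of_real (Re (trig n u m))" "trig n v m = of_real (Re (trig n v m))"
    using trig_real[OF ell_plusD(2)[OF u], of m] trig_real[OF ell_plusD(2)[OF v], of m]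
    by (auto simp: complex_eq_iff)
  ultimately have "a = of_real (Re (trig n u m) / Re (trig n v m))"
    by (metis of_real_divide)
  then obtain r where r: "a = of_real r" by blast
  have scaled: "u = (\<lambda>i. r * v i)"
    using ell_plusD(2)[OF u] ell_plusD(2)[OF v] n_pos uv r \<open>b = 0\<close>
    by (intro trig_inject[of _ n]) (auto simp: ambient_def trig_scale)
  have "(\<Sum>i\<le>n - 2. (u i)\<^sup>2) = 1" "(\<Sum>i\<le>n - 2. (v i)\<^sup>2) = 1"
    using ell_plusD(1)[OF u] ell_plusD(1)[OF v] by (auto simp: nsphere_def)
  then have "r\<^sup>2 = 1"
    by (simp add: scaled power_mult_distrib flip: sum_distrib_left)
  then show ?thesis
    using scaled by (auto simp: power2_eq_1_iff antipode_def)
qed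

text \<open>\<open>rot n\<close> corresponds to the cyclic shift and \<open>antipode\<close> to the
  affine factor -1. Conversely, an affine relation between samples of points of norm 1 leaves only
  the factors 1 and -1.\<close>

lemma shape_orbit_samples_eq_iff:
  assumes x: "x \<in> ell_plus j n" and y: "y \<in> ell_plus j n"
  shows "shape_orbit j (samples n j x) = shape_orbit j (samples n j y) \<longleftrightarrow> orbit n x = orbit n y"
proof -
  have cl: "affine_class j ((cyclic_shift j ^^ i) (samples n j x)) = affine_class j (samples n j ((rot n ^^ i) x))"
    for i
    by (rule affine_class_affine[where \<alpha> = 1 and \<beta> = 0]) (auto simp: samples_rot_power[OF x])
  have "affine_class j (samples n j y) = affine_class j (samples n j ((rot n ^^ i) x)) \<longleftrightarrow>
      y = (rot n ^^ i) x \<or> y = antipode ((rot n ^^ i) x)" for i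
  proof
    assume "y = (rot n ^^ i) x \<or> y = antipode ((rot n ^^ i) x)"
    moreover have "affine_class j (samples n j (antipode z)) = affine_class j (samples n j z)" for z
      by (rule affine_class_affine[where \<alpha> = "-1" and \<beta> = 0]) (auto simp: samples_def trig_antipode)
    ultimately show "affine_class j (samples n j y) = affine_class j (samples n j ((rot n ^^ i) x))"
      by auto
  qed (use affine_class_samples_eqD[OF y rot_power_ell_plus[OF x]] in blast)
  then show ?thesis
    using samples_configs[OF x] samples_configs[OF y] ell_plusD(1)[OF x] ell_plusD(1)[OF y] j_pos n
    by (simp add: shape_orbit_eq_iff cl orbit_eq_iff)
qed

text \<open>Near \<open>c\<close>, a configuration is projected orthogonally to the real direction
  \<open>a\<close>, centred and inverted by Fourier coefficients, and normalised. A collinear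
  \<open>d\<close> is an affine image of its projection unless its line is perpendicular to
  \<open>a\<close>; the neighbourhood \<open>N\<close> excludes that case.\<close>

lemma local_section_shape_orbit:
  assumes c: "c \<in> collinear_configs j"
  shows "\<exists>N s. openin (subtopology (complex_space j) (collinear_configs j)) N \<and> c \<in> N \<and>
      continuous_map (subtopology (subtopology (complex_space j) (collinear_configs j)) N)
        (subtopology (nsphere (n - 2)) (ell_plus j n)) s \<and>
      (\<forall>d\<in>N. shape_orbit j (samples n j (s d)) = shape_orbit j d)"
proof -
  let ?C = "subtopology (complex_space j) (collinear_configs j)"
  have topC: "topspace ?C = collinear_configs j"
    by (auto simp: topspace_complex_space collinear_configs_eq configs_def)
  have "collinear (c ` {..<j})"
    using c by (simp add: collinear_configs_eq)
  then obtain a b y where a: "a \<noteq> 0" and cy: "\<And>i. i < j \<Longrightarrow> c i = a * of_real (y i) + b"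
    by (rule collinear_real_coordinates) blast
  \<comment> \<open>\<open>Re (z / a)\<close> is the real coordinate of the projection to direction
    \<open>a\<close>, and \<open>i mod j\<close> extends the \<open>j\<close> values periodically to
    \<open>n\<close> samples.\<close>
  define g where "g d = of_samples n (\<lambda>i. Re (d (i mod j) / a))" for d :: "nat \<Rightarrow> complex"
  define S where "S d = (\<Sum>i\<le>n - 2. (g d i)\<^sup>2)" for d
  define s where "s d = (\<lambda>i. 1 / sqrt (S d) * g d i)" for d
  define N where "N = {d \<in> topspace ?C. S d \<in> - {0}}"
  define mean where "mean d = (\<Sum>i<n. Re (d (i mod j) / a)) / real n" for d :: "nat \<Rightarrow> complex"
  have amb: "g d \<in> ambient n" for d
    by (simp add: g_def of_samples_ambient)
  have trig_g: "trig n (g d) m = of_real (Re (d (m mod j) / a) - mean d)" for d m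
  proof -
    have "trig n (g d) m = trig n (g d) (m mod n)"
      by (simp add: trig_mod n_pos)
    also have "\<dots> = of_real (Re (d (m mod n mod j) / a) - mean d)"
      using trig_of_samples[of "m mod n" n] n_pos by (simp add: g_def mean_def)
    finally show ?thesis
      using j by (simp add: mod_mod_cancel)
  qed
  have trig_s: "trig n (s d) m = of_real (1 / sqrt (S d)) * trig n (g d) m" for d m
    unfolding s_def by (rule trig_scale)
  have S_zero: "S d = 0 \<longleftrightarrow> g d = (\<lambda>_. 0)" for d
  proof
    assume "S d = 0"
    then have "\<forall>i\<le>n - 2. g d i = 0"
      by (simp add: S_def sum_nonneg_eq_0_iff)
    moreover have "g d i = 0" if "i > n - 2" for i
      using amb[of d] that by (auto simp: ambient_def)
    ultimately show "g d = (\<lambda>_. 0)"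
      by (meson linorder_not_le)
  qed (simp add: S_def)
  have S_pos: "S d > 0" if "S d \<noteq> 0" for d
    using that by (metis S_def less_eq_real_def sum_nonneg zero_le_power2)
  have s_ell: "s d \<in> ell_plus j n" if "S d \<noteq> 0" for d
  proof -
    have amb_s: "s d \<in> ambient n"
      using amb[of d] by (simp add: s_def ambient_def)
    have "(\<Sum>i\<le>n - 2. (s d i)\<^sup>2) = (1 / sqrt (S d))\<^sup>2 * S d"
      unfolding s_def power_mult_distrib S_def sum_distrib_left ..
    also have "\<dots> = 1"
      using S_pos[OF that] by (simp add: power_divide)
    finally have "s d \<in> topspace (nsphere (n - 2))"
      using amb_s n by (auto simp: nsphere_def topspace_Euclidean_space ambient_def)
    moreover have "(rot n ^^ j) (s d) = s d"
      unfolding rot_power_fixed_iff[OF amb_s n_pos] by (simp add: trig_s trig_g)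
    ultimately show ?thesis
      by (simp add: ell_plus_def)
  qed
  have cont_dft: "continuous_map ?C euclidean (\<lambda>d. dft n (\<lambda>i. Re (d (i mod j) / a)) t)" for t
  proof -
    have "continuous_map ?C euclidean (\<lambda>d. d (i mod j))" for i
      using j_pos by (intro continuous_map_from_subtopology continuous_map_complex_space_coordinate) simp
    then show ?thesis
      unfolding continuous_map_euclidean_tendsto dft_def using a n_pos
      by (auto intro!: tendsto_intros)
  qed
  have cont_g: "continuous_map ?C euclidean (\<lambda>d. g d i)" for i
    using cont_dft unfolding g_def of_samples_def continuous_map_euclidean_tendsto
    by (auto intro!: tendsto_intros)
  have cont_S: "continuous_map ?C euclidean S"
    using cont_g unfolding S_def continuous_map_euclidean_tendsto by (auto intro!: tendsto_intros)
  have "openin ?C N"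
    unfolding N_def by (rule openin_continuous_map_preimage[OF cont_S]) (simp add: open_Compl flip: open_openin)
  moreover have "c \<in> N"
  proof -
    \<comment> \<open>If the projection of \<open>c\<close> were constant, so would be its real
      coordinates \<open>y\<close> along \<open>a\<close>, and \<open>c\<close> would lie on the
      diagonal.\<close>
    have "S c \<noteq> 0"
    proof
      assume "S c = 0"
      then have "trig n (g c) m = 0" for m
        using S_zero trig_scale[of n 0 "g c" m] by simp
      then have "Re (c (m mod j) / a) = mean c" for m
        by (metis trig_g eq_iff_diff_eq_0 of_real_eq_0_iff)
      then have "Re (c m / a) = mean c" if "m < j" for m
        using that by (metis mod_less)
      then have "y m = mean c - Re (b / a)" if "m < j" for m
        using that a by (force simp: cy add_divide_distrib)
      then have "\<forall>m<j. c m = a * of_real (mean c - Re (b / a)) + b"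
        by (simp add: cy)
      then show False
        using c by (auto simp: collinear_configs_eq configs_def diagonal_iff)
    qed
    then show ?thesis
      using c topC by (simp add: N_def)
  qed
  moreover have "continuous_map (subtopology ?C N) (subtopology (nsphere (n - 2)) (ell_plus j n)) s"
  proof -
    have "continuous_map (subtopology ?C N) euclidean (\<lambda>d. s d i)" for i
    proof -
      have "continuous_map (subtopology ?C N) euclidean S" "continuous_map (subtopology ?C N) euclidean (\<lambda>d. g d i)"
        using cont_S cont_g by (auto intro: continuous_map_from_subtopology)
      then show ?thesis
        unfolding s_def continuous_map_euclidean_tendsto by (auto simp: N_def intro!: tendsto_intros)
    qed
    moreover have "s d \<in> ell_plus j n" if "d \<in> topspace (subtopology ?C N)" for d
      using that s_ell[of d] by (auto simp: N_def)
    ultimately show ?thesis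
      by (auto simp: continuous_map_in_subtopology ell_plusD(1) intro!: continuous_map_into_nsphere)
  qed
  moreover have "shape_orbit j (samples n j (s d)) = shape_orbit j d" if "d \<in> N" for d
  proof -
    have d: "d \<in> collinear_configs j" and S: "S d \<noteq> 0"
      using that topC by (auto simp: N_def)
    have "collinear (d ` {..<j})"
      using d by (simp add: collinear_configs_eq)
    then obtain a' b' y' where a': "a' \<noteq> 0" and dy: "\<And>i. i < j \<Longrightarrow> d i = a' * of_real (y' i) + b'"
      by (rule collinear_real_coordinates) blast
    \<comment> \<open>The signed factor by which the projection scales coordinates along the line of
      \<open>d\<close>; it is zero only in the perpendicular case.\<close>
    define \<rho> where "\<rho> = Re (a' / a)"
    have Re_d: "Re (d i / a) = \<rho> * y' i + Re (b' / a)" if "i < j" for i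
    proof -
      have "d i / a = (a' / a) * of_real (y' i) + b' / a"
        using that by (simp add: dy add_divide_distrib)
      moreover have "Re (z * of_real r) = Re z * r" for z r
        by simp
      ultimately show ?thesis
        by (simp only: \<rho>_def plus_complex.sel)
    qed
    have "\<rho> \<noteq> 0"
    proof
      assume "\<rho> = 0"
      then have "trig n (g d) m = of_real (Re (b' / a) - mean d)" for m
        using Re_d[of "m mod j"] j_pos by (simp add: trig_g)
      then have "g d = (\<lambda>_. 0)"
        using trig_const_zero amb n_pos by blast
      then show False
        using S S_zero by simp
    qed
    have "affine_class j (samples n j (s d)) = affine_class j d"
    proof (rule affine_class_affine)
      \<comment> \<open>The coefficients come from solving \<open>d m = a' * y' m + b'\<close> for
        \<open>y' m\<close> and inserting this into the centred and normalised projection.\<close>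
      let ?k = "1 / sqrt (S d)"
      show "of_real (?k * \<rho>) / a' \<noteq> 0"
        using \<open>\<rho> \<noteq> 0\<close> a' S_pos[OF S] by simp
      show "samples n j (s d) m = of_real (?k * \<rho>) / a' * d m
          + (of_real (?k * (Re (b' / a) - mean d)) - of_real (?k * \<rho>) / a' * b')"
        if "m < j" for m
      proof -
        have "samples n j (s d) m = of_real (?k * (\<rho> * y' m + Re (b' / a) - mean d))"
          using that Re_d[OF that] by (simp add: samples_def trig_s trig_g)
        moreover have "of_real (?k * \<rho>) / a' * d m = of_real (?k * \<rho> * y' m) + of_real (?k * \<rho>) / a' * b'"
          using that a' by (simp add: dy distrib_left)
        ultimately show ?thesis
          by (simp add: algebra_simps)
      qed
    qed
    then show ?thesis
      by (simp add: shape_orbit_def)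
  qed
  ultimately show ?thesis by blast
qed

lemma quotient_map_ell_plus:
  "quotient_map (subtopology (nsphere (n - 2)) (ell_plus j n)) (linear_shapes j)
    (\<lambda>x. shape_orbit j (samples n j x))"
proof (rule quotient_map_local_sections[OF quotient_map_shape_orbit])
  let ?X = "subtopology (nsphere (n - 2)) (ell_plus j n)"
  have "continuous_map ?X (subtopology (complex_space j) (collinear_configs j)) (samples n j)"
    unfolding continuous_map_in_subtopology continuous_map_complex_space topspace_ell_plus
    using samples_collinear continuous_map_nsphere_euclidean[OF continuous_on_trig, of "n - 2" n]
    by (auto simp: samples_def intro: continuous_map_from_subtopology)
  then show "continuous_map ?X (linear_shapes j) (\<lambda>x. shape_orbit j (samples n j x))"
    using continuous_map_compose quotient_imp_continuous_map[OF quotient_map_shape_orbit]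
    by (fastforce simp: comp_def)
qed (use local_section_shape_orbit in auto)

end

section \<open>Lens spaces\<close>

lemma topspace_complex_sphere:
  "topspace (complex_sphere m) = {z \<in> extensional {..<m}. (\<Sum>i<m. (cmod (z i))\<^sup>2) = 1}"
  by (auto simp: complex_sphere_def topspace_complex_space)

text \<open>A closed subset of a product of closed unit discs, as each coordinate is bounded by the
  norm.\<close>

lemma compact_space_complex_sphere: "compact_space (complex_sphere m)"
proof -
  let ?S = "{z. (\<Sum>i<m. (cmod (z i))\<^sup>2) = 1}"
  let ?B = "PiE {..<m} (\<lambda>_. cball (0 :: complex) 1)"
  have "compactin (complex_space m) ?B"
    by (simp add: complex_space_def compactin_PiE)
  moreover have "closedin (complex_space m) {z \<in> topspace (complex_space m). (\<Sum>i<m. (cmod (z i))\<^sup>2) \<in> {1}}"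
  proof (rule closedin_continuous_map_preimage)
    show "continuous_map (complex_space m) euclideanreal (\<lambda>z. \<Sum>i<m. (cmod (z i))\<^sup>2)"
      using continuous_map_complex_space_coordinate
      unfolding continuous_map_euclidean_tendsto by (auto intro!: tendsto_intros)
  qed auto
  moreover have "{z \<in> topspace (complex_space m). (\<Sum>i<m. (cmod (z i))\<^sup>2) \<in> {1}} =
      topspace (complex_space m) \<inter> ?S"
    by auto
  ultimately have "closedin (complex_space m) (topspace (complex_space m) \<inter> ?S)"
    and "compactin (complex_space m) ?B"
    by simp_all
  moreover have "topspace (complex_space m) \<inter> ?S \<subseteq> ?B"
  proof
    fix z assume z: "z \<in> topspace (complex_space m) \<inter> ?S"
    have "cmod (z i) \<le> 1" if "i < m" for i
    proof -
      have "(cmod (z i))\<^sup>2 \<le> (\<Sum>i<m. (cmod (z i))\<^sup>2)"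
        using that by (intro member_le_sum) auto
      then show ?thesis
        using z by (simp add: abs_square_le_1)
    qed
    then show "z \<in> ?B"
      using z by (auto simp: topspace_complex_space PiE_def)
  qed
  ultimately have "compactin (complex_space m) (topspace (complex_space m) \<inter> ?S)"
    using closed_compactin by blast
  then have "compact_space (subtopology (complex_space m) (topspace (complex_space m) \<inter> ?S))"
    by (rule compact_space_subtopology)
  then show ?thesis
    unfolding complex_sphere_def subtopology_restrict .
qed

lemma lens_rotation_eq:
  "lens_rotation q p z = (\<lambda>i\<in>{..<length p}. unity q (p ! i) * z i)"
  by (simp add: lens_rotation_def unity_def)

lemma lens_rotation_power:
  "z \<in> extensional {..<length p} \<Longrightarrow>
    (lens_rotation q p ^^ l) z = (\<lambda>i\<in>{..<length p}. unity q (p ! i * int l) * z i)"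
proof (induction l)
  case 0
  then show ?case
    by (simp add: extensional_restrict)
next
  case (Suc l)
  then show ?case
    by (auto simp: lens_rotation_eq distrib_left unity_add mult_ac)
qed

lemma commuting_maps_lens_rotation:
  assumes "q > 0"
  shows "commuting_maps (topspace (complex_sphere (length p))) (lens_rotation q p) (lens_rotation q p) q q"
proof
  fix z assume z: "z \<in> topspace (complex_sphere (length p))"
  then show "lens_rotation q p z \<in> topspace (complex_sphere (length p))"
    by (simp add: topspace_complex_sphere lens_rotation_eq norm_mult)
  show "(lens_rotation q p ^^ q) z = z"
    using z unity_multiple[OF assms]
    by (simp add: topspace_complex_sphere lens_rotation_power extensional_restrict mult.commute[of _ "int q"])
qed (use assms in auto)

lemma lens_class_eq_iff:
  assumes "q > 0" and z: "z \<in> topspace (complex_sphere (length p))"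
    and w: "w \<in> topspace (complex_sphere (length p))"
  shows "lens_class q p z = lens_class q p w \<longleftrightarrow>
    (\<exists>l. \<forall>i<length p. w i = unity q (p ! i * int l) * z i)"
proof -
  interpret commuting_maps "topspace (complex_sphere (length p))" "lens_rotation q p" "lens_rotation q p" q q
    by (rule commuting_maps_lens_rotation[OF assms(1)])
  have "lens_class q p z = lens_class q p w \<longleftrightarrow> (\<exists>l l'. w = (lens_rotation q p ^^ l) ((lens_rotation q p ^^ l') z))"
    using generated_orbit_eq_iff[OF z w] by (simp add: lens_class_def)
  also have "\<dots> \<longleftrightarrow> (\<exists>l. w = (lens_rotation q p ^^ l) z)"
    by (metis add.right_neutral comp_apply funpow_add)
  also have "\<dots> \<longleftrightarrow> (\<exists>l. \<forall>i<length p. w i = unity q (p ! i * int l) * z i)"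
    using z w by (auto simp: topspace_complex_sphere lens_rotation_power fun_eq_iff extensional_def)
  finally show ?thesis .
qed

lemma quotient_map_lens_class:
  "quotient_map (complex_sphere (length p)) (lens_space q p) (lens_class q p)"
  using quotient_map_quotient_topology[of "complex_sphere (length p)" "lens_class q p"]
  by (simp add: lens_space_def orbit_space_def lens_class_def[abs_def])

lemma length_odds_below [simp]: "length (odds_below j) = j div 2"
  by (simp add: odds_below_def)

lemma nth_odds_below [simp]: "s < j div 2 \<Longrightarrow> odds_below j ! s = 2 * int s + 1"
  by (simp add: odds_below_def)

section \<open>The sphere on which the \<open>j\<close>-th power is antipodal\<close>

text \<open>\<open>h\<close> is half of \<open>k\<close>. The index \<open>n div 2 = h * j\<close>
  of the last block is an odd multiple of \<open>h\<close> exactly for odd \<open>j\<close>; this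
  parity decides whether the last coordinate takes part.\<close>

locale antipodal_sphere =
  fixes n j h :: nat
  assumes n_eq: "n = 2 * h * j" and h_pos: "h > 0" and j_pos: "j > 0"
begin

lemma n_ge_2: "n \<ge> 2" and n_pos: "n > 0"
  using n_eq h_pos j_pos by (simp_all add: Suc_le_eq)

lemma n_div_2: "n div 2 = h * j"
  by (simp add: n_eq)

section \<open>Blocks on which the \<open>j\<close>-th power is minus the identity\<close>

definition odd_multiple :: "nat \<Rightarrow> bool" where
  "odd_multiple t \<longleftrightarrow> h dvd t \<and> odd (t div h)"

lemma odd_multiple_div [simp]: "((2 * s + 1) * h) div h div 2 = s"
  using h_pos by simp

lemma odd_multipleE:
  assumes "odd_multiple t"
  obtains s where "t = (2 * s + 1) * h" "t div h div 2 = s"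
proof -
  obtain c where "t = h * c" "odd c"
    using assms h_pos by (auto simp: odd_multiple_def elim!: dvdE)
  then obtain s where s: "t = (2 * s + 1) * h"
    by (metis mult.commute oddE)
  then have "t div h div 2 = s"
    using odd_multiple_div by metis
  with s show thesis
    by (rule that)
qed

lemma odd_multiple_le: "2 * ((2 * s + 1) * h) \<le> n \<Longrightarrow> 2 * s + 1 \<le> j"
proof -
  assume "2 * ((2 * s + 1) * h) \<le> n"
  then have "(2 * s + 1) * h \<le> j * h"
    by (simp add: n_eq mult_ac)
  then show ?thesis
    using mult_le_cancel2[of "2 * s + 1" h j] h_pos by blast
qed

lemma unity_odd_multiple:
  assumes "odd_multiple t"
  shows "unity n (int t * int j) = - 1"
proof -
  obtain s where t: "t = (2 * s + 1) * h"
    using assms odd_multipleE by metis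
  have "int t * int j = int h * int j + int n * int s"
    unfolding t n_eq by (simp add: algebra_simps)
  then have "unity n (int t * int j) = unity n (int h * int j)"
    using unity_shift n_pos by metis
  also have "\<dots> = cis pi"
    using h_pos j_pos by (simp add: unity_def n_eq)
  finally show ?thesis
    by simp
qed

text \<open>Squaring gives \<open>n dvd 2 * j * t\<close>, hence \<open>h dvd t\<close>; an even
  quotient would yield the value 1.\<close>

lemma unity_eq_minus_1D:
  assumes "unity n (int t * int j) = - 1"
  shows "odd_multiple t"
proof -
  have "unity n (int t * int j + int t * int j) = 1"
    unfolding unity_add assms by simp
  then have "int n dvd int t * int j + int t * int j"
    using unity_eq_1_iff n_pos by blast
  moreover have "int t * int j + int t * int j = int (2 * j * t)" "int n = int (2 * j * h)"
    by (simp_all add: n_eq)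
  ultimately have "2 * j * h dvd 2 * j * t"
    by (metis of_nat_dvd_iff)
  then have "h dvd t"
    using j_pos by simp
  moreover have "odd (t div h)"
  proof
    assume "even (t div h)"
    then obtain c where "t = h * (2 * c)"
      using \<open>h dvd t\<close> by (metis dvd_mult_div_cancel evenE)
    then have "int t * int j = int n * int c"
      by (simp add: n_eq)
    then show False
      using assms unity_multiple[OF n_pos] by simp
  qed
  ultimately show ?thesis
    by (simp add: odd_multiple_def)
qed

text \<open>The \<open>j\<close>-th power and the antipode act on each block by scalars, so a block
  can be nonzero only where the scalar of the power is -1.\<close>

lemma ell_minus_iff:
  "x \<in> ell_minus j n \<longleftrightarrow> x \<in> topspace (nsphere (n - 2)) \<and>
    (\<forall>t. 1 \<le> t \<longrightarrow> 2 * t \<le> n \<longrightarrow> \<not> odd_multiple t \<longrightarrow> block x t = 0)"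
proof (cases "x \<in> topspace (nsphere (n - 2))")
  case True
  then have x: "x \<in> ambient n"
    using n_ge_2 by (simp add: topspace_nsphere_iff)
  have "(rot n ^^ j) x = antipode x \<longleftrightarrow>
      (\<forall>t. 1 \<le> t \<longrightarrow> 2 * t \<le> n \<longrightarrow> unity n (int t * int j) * block x t = - block x t)"
    using ambient_eqI[OF rot_power_ambient[OF x] antipode_ambient[OF x]]
    by (metis block_antipode block_rot_power x)
  also have "\<dots> \<longleftrightarrow> (\<forall>t. 1 \<le> t \<longrightarrow> 2 * t \<le> n \<longrightarrow> \<not> odd_multiple t \<longrightarrow> block x t = 0)"
  proof -
    have "unity n (int t * int j) * block x t = - block x t \<longleftrightarrow> odd_multiple t \<or> block x t = 0" for t
      using unity_odd_multiple unity_eq_minus_1D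
      by (metis minus_zero mult_cancel_right mult_minus1 mult_zero_right)
    then show ?thesis by blast
  qed
  finally show ?thesis
    using True by (simp add: ell_minus_def)
qed (simp add: ell_minus_def)

text \<open>The inverse of reading off block coordinates: \<open>t div h div 2\<close> recovers
  \<open>s\<close> from \<open>t = (2 * s + 1) * h\<close>. For odd \<open>j\<close> the value
  \<open>r\<close> goes to coordinate \<open>n - 2\<close>, in the half block
  \<open>2 * t = n\<close>, where \<open>s = j div 2\<close>.\<close>

definition embed :: "(nat \<Rightarrow> complex) \<Rightarrow> real \<Rightarrow> nat \<Rightarrow> real" where
  "embed w r = (\<lambda>i. let t = i div 2 + 1; s = t div h div 2 in
     if i \<ge> n - 1 \<or> \<not> odd_multiple t then 0
     else if s < j div 2 then (if even i then Re (w s) else Im (w s)) else r)"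

lemma embed_ambient: "embed w r \<in> ambient n"
  by (simp add: embed_def ambient_def)

lemma block_embed:
  assumes t: "1 \<le> t" "2 * t \<le> n"
  shows "block (embed w r) t = (if \<not> odd_multiple t then 0
    else if t div h div 2 < j div 2 then w (t div h div 2) else of_real r)"
proof -
  have div: "(2 * t - 2) div 2 + 1 = t" "(2 * t - 1) div 2 + 1 = t" "even (2 * t - 2)" "odd (2 * t - 1)"
    using t by presburger+
  have re: "embed w r (2 * t - 2) = (if n - 1 \<le> 2 * t - 2 \<or> \<not> odd_multiple t then 0
      else if t div h div 2 < j div 2 then Re (w (t div h div 2)) else r)"
    by (simp only: embed_def Let_def div if_True)
  have im: "embed w r (2 * t - 1) = (if n - 1 \<le> 2 * t - 1 \<or> \<not> odd_multiple t then 0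
      else if t div h div 2 < j div 2 then Im (w (t div h div 2)) else r)"
    by (simp only: embed_def Let_def div if_False)
  \<comment> \<open>Beyond the full blocks, \<open>2 * s + 1\<close> is at most \<open>j\<close> and
    thus equal to it. This is the half block, whose imaginary slot \<open>n - 1\<close> is cut
    off.\<close>
  have mid: "2 * t = n" if odd: "odd_multiple t" "\<not> t div h div 2 < j div 2"
  proof -
    obtain s where s: "t = (2 * s + 1) * h" "t div h div 2 = s"
      using odd(1) by (rule odd_multipleE)
    then have "2 * s + 1 \<le> j"
      using t odd_multiple_le by blast
    moreover have "\<not> s < j div 2"
      using odd(2) s(2) by simp
    ultimately have "2 * s + 1 = j"
      by presburger
    then show ?thesis
      unfolding s(1) n_eq by simp
  qed
  have small: "2 * t < n" if odd: "odd_multiple t" "t div h div 2 < j div 2"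
  proof -
    obtain s where s: "t = (2 * s + 1) * h" "t div h div 2 = s"
      using odd(1) by (rule odd_multipleE)
    then have "s < j div 2"
      using odd(2) by simp
    then have "2 * s + 1 < j"
      by presburger
    then have "(2 * s + 1) * h < j * h"
      using h_pos mult_less_cancel2 by blast
    then show ?thesis
      by (simp add: s(1) n_eq mult_ac)
  qed
  show ?thesis
  proof (cases "odd_multiple t")
    case False
    then show ?thesis
      unfolding block_def re im by (simp add: complex_eq_iff)
  next
    case True
    show ?thesis
    proof (cases "t div h div 2 < j div 2")
      case s: True
      have "\<not> n - 1 \<le> 2 * t - 2" "\<not> n - 1 \<le> 2 * t - 1"
        using small[OF True s] t by auto
      then show ?thesis
        unfolding block_def re im using True s by (simp add: complex_eq_iff)
    next
      case s: False
      have "\<not> n - 1 \<le> 2 * t - 2" "n - 1 \<le> 2 * t - 1"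
        using mid[OF True s] t by auto
      then show ?thesis
        unfolding block_def re im using True s by (simp add: complex_eq_iff)
    qed
  qed
qed

lemma block_embed_mult: "s < j div 2 \<Longrightarrow> block (embed w r) ((2 * s + 1) * h) = w s"
proof -
  assume s: "s < j div 2"
  then have "(2 * s + 1) * h \<le> j * h"
    by (intro mult_right_mono) auto
  then show ?thesis
    using s h_pos by (subst block_embed) (auto simp: n_eq mult_ac odd_multiple_def)
qed

lemma embed_last: "odd j \<Longrightarrow> embed w r (n - 2) = r"
proof -
  assume "odd j"
  have "(n - 2) div 2 + 1 = h * j"
    using n_ge_2 n_div_2 by simp
  moreover have "odd_multiple (h * j)" "h * j div h div 2 = j div 2"
    using h_pos \<open>odd j\<close> by (auto simp: odd_multiple_def)
  ultimately show ?thesis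
    using n_ge_2 by (simp add: embed_def Let_def)
qed

lemma embed_eq_iff:
  "embed w r = embed w' r' \<longleftrightarrow> (\<forall>s<j div 2. w s = w' s) \<and> (odd j \<longrightarrow> r = r')"
proof
  assume "embed w r = embed w' r'"
  then show "(\<forall>s<j div 2. w s = w' s) \<and> (odd j \<longrightarrow> r = r')"
    using block_embed_mult embed_last by metis
next
  assume eq: "(\<forall>s<j div 2. w s = w' s) \<and> (odd j \<longrightarrow> r = r')"
  have "odd j" if t: "1 \<le> t" "2 * t \<le> n" and odd: "odd_multiple t" "\<not> t div h div 2 < j div 2" for t
  proof -
    obtain s where s: "t = (2 * s + 1) * h" "t div h div 2 = s"
      using odd(1) by (rule odd_multipleE)
    then have "2 * s + 1 \<le> j"
      using t odd_multiple_le by blast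
    moreover have "\<not> s < j div 2"
      using odd(2) s(2) by simp
    ultimately show ?thesis
      by presburger
  qed
  then show "embed w r = embed w' r'"
    by (intro ambient_eqI[OF embed_ambient embed_ambient]) (use eq in \<open>auto simp: block_embed\<close>)
qed

lemma sum_squares_embed:
  "(\<Sum>t = 1..n div 2. (cmod (block (embed w r) t))\<^sup>2) =
    (\<Sum>s<j div 2. (cmod (w s))\<^sup>2) + (if odd j then r\<^sup>2 else 0)"
proof -
  let ?f = "\<lambda>t. (cmod (block (embed w r) t))\<^sup>2" and ?g = "\<lambda>s. (2 * s + 1) * h"
  have inj: "inj_on ?g A" for A
    using h_pos by (auto simp: inj_on_def)
  \<comment> \<open>\<open>(j + 1) div 2\<close> counts the odd numbers up to \<open>j\<close>. For
    odd \<open>j\<close> this is one more than the number of full blocks, and the additional one,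
    \<open>j\<close> itself, carries \<open>r\<close>.\<close>
  have "(\<Sum>t = 1..n div 2. ?f t) = (\<Sum>t\<in>?g ` {..<(j + 1) div 2}. ?f t)"
  proof (rule sum.mono_neutral_right)
    show "?g ` {..<(j + 1) div 2} \<subseteq> {1..n div 2}"
    proof
      fix t assume "t \<in> ?g ` {..<(j + 1) div 2}"
      then obtain s where s: "t = (2 * s + 1) * h" "s < (j + 1) div 2"
        by blast
      have "2 * s + 1 \<le> j"
        using s(2) by presburger
      then have "(2 * s + 1) * h \<le> j * h"
        by (rule mult_right_mono) simp
      moreover have "1 \<le> (2 * s + 1) * h"
        using h_pos by simp
      ultimately show "t \<in> {1..n div 2}"
        unfolding n_div_2 s(1) atLeastAtMost_iff mult.commute[of h j] by blast
    qed
    show "\<forall>t\<in>{1..n div 2} - ?g ` {..<(j + 1) div 2}. ?f t = 0"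
    proof
      fix t assume t: "t \<in> {1..n div 2} - ?g ` {..<(j + 1) div 2}"
      have "\<not> odd_multiple t"
      proof
        assume "odd_multiple t"
        then obtain s where s: "t = (2 * s + 1) * h"
          using odd_multipleE by metis
        have "2 * t \<le> n"
          using t by auto
        then have "2 * s + 1 \<le> j"
          using s odd_multiple_le by blast
        then have "s < (j + 1) div 2"
          by presburger
        then show False
          using t s by blast
      qed
      moreover have "1 \<le> t" "2 * t \<le> n"
        using t by auto
      ultimately show "?f t = 0"
        by (simp add: block_embed)
    qed
  qed simp
  also have "\<dots> = (\<Sum>s<(j + 1) div 2. ?f (?g s))"
    by (simp only: sum.reindex[OF inj] comp_def)
  also have "\<dots> = (\<Sum>s<j div 2. ?f (?g s)) + (if odd j then ?f (?g (j div 2)) else 0)"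
    by (auto elim!: oddE)
  also have "(\<Sum>s<j div 2. ?f (?g s)) = (\<Sum>s<j div 2. (cmod (w s))\<^sup>2)"
    by (intro sum.cong refl arg_cong[where f = "\<lambda>z. (cmod z)\<^sup>2"] block_embed_mult) simp
  also have "?f (?g (j div 2)) = r\<^sup>2" if "odd j"
  proof -
    have g: "?g (j div 2) = j * h"
      using that by (simp add: odd_two_times_div_two_succ)
    have "odd_multiple (j * h)" "j * h div h div 2 = j div 2"
      using that h_pos by (auto simp: odd_multiple_def)
    moreover have "1 \<le> j * h" "2 * (j * h) \<le> n"
      using h_pos j_pos by (simp_all add: n_eq Suc_le_eq)
    ultimately show ?thesis
      unfolding g by (simp add: block_embed)
  qed
  ultimately show ?thesis
    by (auto simp del: One_nat_def)
qed

lemma embed_ell_minus_iff: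
  "embed w r \<in> ell_minus j n \<longleftrightarrow> (\<Sum>s<j div 2. (cmod (w s))\<^sup>2) + (if odd j then r\<^sup>2 else 0) = 1"
  using sum_squares_embed[of w r] n_ge_2
  by (simp add: ell_minus_iff topspace_nsphere_iff embed_ambient block_embed)

definition coords :: "(nat \<Rightarrow> real) \<Rightarrow> nat \<Rightarrow> complex" where
  "coords x = (\<lambda>s\<in>{..<j div 2}. block x ((2 * s + 1) * h))"

lemma block_coords_eq: "block_coords j (2 * h) x = coords x"
  by (simp add: block_coords_def coords_def block_def mult_ac distrib_left)

lemma coords_embed: "coords (embed w r) = restrict w {..<j div 2}"
  unfolding coords_def by (intro restrict_ext) (simp add: block_embed_mult del: One_nat_def)

lemma coords_antipode: "coords (antipode x) = (\<lambda>s\<in>{..<j div 2}. - coords x s)"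
  by (auto simp: coords_def block_antipode)

lemma embed_coords:
  assumes x: "x \<in> ell_minus j n"
  shows "embed (coords x) (x (n - 2)) = x"
proof (rule ambient_eqI[OF embed_ambient])
  show amb: "x \<in> ambient n"
    using x n_ge_2 by (simp add: ell_minus_iff topspace_nsphere_iff)
  fix t assume t: "1 \<le> t" "2 * t \<le> n"
  show "block (embed (coords x) (x (n - 2))) t = block x t"
  proof (cases "odd_multiple t")
    case True
    then obtain s where s: "t = (2 * s + 1) * h"
      using odd_multipleE by metis
    show ?thesis
    proof (cases "s < j div 2")
      case False
      have "2 * s + 1 \<le> j"
        using t s odd_multiple_le by blast
      then have "2 * s + 1 = j"
        using False by presburger
      then have "2 * t = n"
        unfolding s n_eq by simp
      then have "block x t = of_real (x (n - 2))"
        using amb t by (auto simp: block_def complex_eq_iff ambient_def)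
      then show ?thesis
        using t True False s h_pos by (simp add: block_embed)
    qed (simp only: s block_embed_mult, simp add: coords_def)
  next
    case False
    then show ?thesis
      using t x by (simp add: block_embed ell_minus_iff)
  qed
qed

text \<open>The last coordinate obeys the same rule as the complex ones: it is the case
  \<open>2 * s + 1 = j\<close>, where the root of unity of modulus \<open>2 * j\<close> equals
  -1.\<close>

lemma rot_power_embed:
  "(rot n ^^ i) (embed w r) = embed (\<lambda>s. unity (2 * j) ((2 * int s + 1) * int i) * w s) ((- 1) ^ i * r)"
proof (rule ambient_eqI[OF rot_power_ambient[OF embed_ambient] embed_ambient])
  fix t assume t: "1 \<le> t" "2 * t \<le> n"
  show "block ((rot n ^^ i) (embed w r)) t =
      block (embed (\<lambda>s. unity (2 * j) ((2 * int s + 1) * int i) * w s) ((- 1) ^ i * r)) t"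
  proof (cases "odd_multiple t")
    case True
    then obtain s where s: "t = (2 * s + 1) * h"
      using odd_multipleE by metis
    have sd: "t div h div 2 = s"
      unfolding s by (rule odd_multiple_div)
    have u: "unity n (int t * int i) = unity (2 * j) ((2 * int s + 1) * int i)"
      unfolding unity_def
      by (rule arg_cong[of _ _ cis]) (use h_pos j_pos in \<open>simp add: s n_eq field_simps\<close>)
    show ?thesis
    proof (cases "s < j div 2")
      case s': True
      then show ?thesis
        using t True by (simp add: block_rot_power embed_ambient block_embed sd u)
    next
      case False
      have "2 * s + 1 \<le> j"
        using t s odd_multiple_le by blast
      then have "2 * s + 1 = j"
        using False by presburger
      then have "2 * int s + 1 = int j"
        by simp
      then have "unity (2 * j) ((2 * int s + 1) * int i) = unity (2 * j) (int j) ^ i"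
        by (simp add: unity_power)
      also have "unity (2 * j) (int j) = - 1"
        using j_pos by (simp add: unity_def)
      finally show ?thesis
        using t True False by (simp add: block_rot_power embed_ambient block_embed sd u)
    qed
  next
    case False
    then show ?thesis
      using t by (simp add: block_rot_power embed_ambient block_embed)
  qed
qed

section \<open>Orbits on the antipodal sphere\<close>

lemma ell_minus_nsphere: "x \<in> ell_minus j n \<Longrightarrow> x \<in> topspace (nsphere (n - 2))"
  by (simp add: ell_minus_def)

lemma rot_ell_minus: "x \<in> ell_minus j n \<Longrightarrow> rot n x \<in> ell_minus j n"
  using rot_nsphere[OF n_ge_2] funpow_swap1[of "rot n" j x]
  by (simp add: ell_minus_def antipode_rot)

lemma antipode_ell_minus: "x \<in> ell_minus j n \<Longrightarrow> antipode x \<in> ell_minus j n"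
  using antipode_nsphere[OF n_ge_2] by (simp add: ell_minus_def rot_power_antipode)

lemma rot_power_ell_minus: "x \<in> ell_minus j n \<Longrightarrow> (rot n ^^ i) x \<in> ell_minus j n"
  by (induction i) (auto simp: rot_ell_minus)

text \<open>Here \<open>antipode\<close> is itself the power \<open>rot n ^^ j\<close>, so the group
  acts through powers of \<open>rot n\<close> alone.\<close>

lemma orbit_ell_minus_eq_iff:
  assumes x: "x \<in> ell_minus j n" and y: "y \<in> ell_minus j n"
  shows "orbit n x = orbit n y \<longleftrightarrow> (\<exists>i. y = (rot n ^^ i) x)"
proof -
  have "antipode ((rot n ^^ i) x) = (rot n ^^ (j + i)) x" for i
    using rot_power_ell_minus[OF x, of i] by (simp add: ell_minus_def funpow_add)
  then show ?thesis
    using orbit_eq_iff[OF n_ge_2] x y ell_minus_nsphere by metis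
qed

text \<open>Both \<open>e\<close> and the orbit map are closed, and a continuous closed surjection
  is a quotient map. Asking \<open>e\<close> to meet every orbit, rather than every point, lets it
  parametrise just a hemisphere.\<close>

lemma quotient_map_orbit_ell_minus:
  assumes S: "compact_space S" and e: "continuous_map S (subtopology (nsphere (n - 2)) (ell_minus j n)) e"
    and surj: "\<And>x. x \<in> ell_minus j n \<Longrightarrow> \<exists>s\<in>topspace S. orbit n (e s) = orbit n x"
  shows "quotient_map S (orbit_space (nsphere (n - 2)) {rot n, antipode} (ell_minus j n)) (\<lambda>s. orbit n (e s))"
proof -
  let ?X = "subtopology (nsphere (n - 2)) (ell_minus j n)"
  let ?Y = "orbit_space (nsphere (n - 2)) {rot n, antipode} (ell_minus j n)"
  have topX: "topspace ?X = ell_minus j n"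
    using ell_minus_nsphere by auto
  have "Hausdorff_space (nsphere (n - 2))"
    unfolding nsphere_def by (intro Hausdorff_space_subtopology Hausdorff_Euclidean_space)
  then have "Hausdorff_space ?X"
    by (rule Hausdorff_space_subtopology)
  then have "closed_map S ?X e"
    using S e continuous_imp_closed_map by blast
  moreover have "closed_map ?X ?Y (orbit n)"
    unfolding orbit_def
    using commuting_maps_rot_antipode[OF n_ge_2] continuous_map_rot[OF n_ge_2] continuous_map_antipode[OF n_ge_2]
    by (rule closed_map_generated_orbit) (auto simp: ell_minus_nsphere rot_ell_minus antipode_ell_minus)
  ultimately have "closed_map S ?Y (orbit n \<circ> e)"
    by (rule closed_map_compose)
  moreover have q: "quotient_map ?X ?Y (orbit n)"
    unfolding orbit_space_def orbit_def by (rule quotient_map_quotient_topology)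
  then have "continuous_map S ?Y (orbit n \<circ> e)"
    using e continuous_map_compose quotient_imp_continuous_map by blast
  moreover have "(orbit n \<circ> e) ` topspace S = topspace ?Y"
  proof -
    have "topspace ?Y = orbit n ` ell_minus j n"
      using quotient_imp_surjective_map[OF q] topX by simp
    moreover have "e ` topspace S \<subseteq> ell_minus j n"
      using continuous_map_image_subset_topspace[OF e] topX by simp
    ultimately have "(orbit n \<circ> e) ` topspace S \<subseteq> topspace ?Y"
      by auto
    moreover have "topspace ?Y \<subseteq> (orbit n \<circ> e) ` topspace S"
    proof
      fix c assume "c \<in> topspace ?Y"
      then obtain x where "x \<in> ell_minus j n" "c = orbit n x"
        unfolding \<open>topspace ?Y = orbit n ` ell_minus j n\<close> by blast
      then obtain s where "s \<in> topspace S" "c = (orbit n \<circ> e) s"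
        using surj by force
      then show "c \<in> (orbit n \<circ> e) ` topspace S"
        by blast
    qed
    ultimately show ?thesis
      by (rule subset_antisym)
  qed
  ultimately have "quotient_map S ?Y (orbit n \<circ> e)"
    by (intro continuous_closed_imp_quotient_map)
  then show ?thesis
    by (simp add: comp_def)
qed

lemma continuous_map_embed:
  assumes "\<And>s. s < j div 2 \<Longrightarrow> continuous_map S euclidean (\<lambda>p. w p s)"
    and "continuous_map S euclideanreal r"
    and "\<And>p. p \<in> topspace S \<Longrightarrow> embed (w p) (r p) \<in> ell_minus j n"
  shows "continuous_map S (subtopology (nsphere (n - 2)) (ell_minus j n)) (\<lambda>p. embed (w p) (r p))"
proof -
  have "continuous_map S euclideanreal (\<lambda>p. embed (w p) (r p) i)" for i
  proof (cases "i \<ge> n - 1 \<or> \<not> odd_multiple (i div 2 + 1)")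
    case True
    then show ?thesis
      by (auto simp: embed_def Let_def)
  next
    case False
    show ?thesis
    proof (cases "(i div 2 + 1) div h div 2 < j div 2")
      case True
      then show ?thesis
        using False assms(1)[OF True] unfolding embed_def Let_def continuous_map_euclidean_tendsto
        by (cases "even i") (auto intro!: tendsto_intros)
    next
      case s: False
      then show ?thesis
        using False assms(2) by (simp add: embed_def Let_def)
    qed
  qed
  then have "continuous_map S (nsphere (n - 2)) (\<lambda>p. embed (w p) (r p))"
    using assms(3) ell_minus_nsphere by (intro continuous_map_into_nsphere) auto
  then show ?thesis
    using assms(3) by (auto simp: continuous_map_in_subtopology)
qed

text \<open>For even \<open>j\<close> there is no half block, so the complex coordinates alone
  parametrise the sphere, and the fibres of both quotients are the orbits of one diagonal rotation
  of modulus \<open>2 * j\<close>.\<close>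

lemma ell_minus_even:
  assumes "even j"
  shows "orbit_space (nsphere (n - 2)) {rot n, antipode} (ell_minus j n)
    homeomorphic_space lens_space (2 * j) (odds_below j)"
proof (rule homeomorphic_space_same_fibres)
  let ?S = "complex_sphere (j div 2)"
  have inS: "embed w 0 \<in> ell_minus j n" if "w \<in> topspace ?S" for w
    using that assms by (simp add: embed_ell_minus_iff topspace_complex_sphere)
  show "quotient_map ?S (orbit_space (nsphere (n - 2)) {rot n, antipode} (ell_minus j n)) (\<lambda>w. orbit n (embed w 0))"
  proof (rule quotient_map_orbit_ell_minus[OF compact_space_complex_sphere])
    show "continuous_map ?S (subtopology (nsphere (n - 2)) (ell_minus j n)) (\<lambda>w. embed w 0)"
      using inS continuous_map_complex_space_coordinate
      by (intro continuous_map_embed) (auto simp: complex_sphere_def intro: continuous_map_from_subtopology)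
    fix x assume x: "x \<in> ell_minus j n"
    have eq: "embed (coords x) 0 = x"
      using embed_coords[OF x] assms embed_eq_iff by metis
    then have "coords x \<in> topspace ?S"
      using x assms embed_ell_minus_iff[of "coords x" 0] by (simp add: topspace_complex_sphere coords_def)
    then show "\<exists>w\<in>topspace ?S. orbit n (embed w 0) = orbit n x"
      using eq by metis
  qed
  show "quotient_map ?S (lens_space (2 * j) (odds_below j)) (lens_class (2 * j) (odds_below j))"
    using quotient_map_lens_class[of "odds_below j"] by simp
  show "orbit n (embed w 0) = orbit n (embed w' 0) \<longleftrightarrow>
      lens_class (2 * j) (odds_below j) w = lens_class (2 * j) (odds_below j) w'"
    if "w \<in> topspace ?S" "w' \<in> topspace ?S" for w w'
    using that inS assms j_pos lens_class_eq_iff[of "2 * j" w "odds_below j" w']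
    by (simp add: orbit_ell_minus_eq_iff rot_power_embed embed_eq_iff)
qed

section \<open>The closed hemisphere as a folded cone\<close>

definition cylinder :: "((nat \<Rightarrow> complex) \<times> real + unit) topology" where
  "cylinder = prod_topology (complex_sphere (j div 2)) (top_of_set {0..1}) \<squnion>\<^sub>t discrete_topology {()}"

text \<open>Cylindrical coordinates on the hemisphere: \<open>t\<close> is the height and
  \<open>w\<close> the direction, at radius \<open>sqrt (1 - t\<^sup>2)\<close>. The isolated point
  goes to the pole; for \<open>j = 1\<close> there are no directions and it is the whole
  cylinder.\<close>

definition cap :: "(nat \<Rightarrow> complex) \<times> real + unit \<Rightarrow> nat \<Rightarrow> real" where
  "cap s = (case s of Inl (w, t) \<Rightarrow> embed (\<lambda>i. of_real (sqrt (1 - t\<^sup>2)) * w i) t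
    | Inr _ \<Rightarrow> embed (\<lambda>_. 0) 1)"

definition lens_cylinder :: "(nat \<Rightarrow> complex) \<times> real + unit \<Rightarrow> (nat \<Rightarrow> complex) set \<times> real + unit" where
  "lens_cylinder = map_sum (\<lambda>(w, t). (lens_class j (odds_below j) w, t)) id"

abbreviation gluing where
  "gluing \<equiv> cone_gluing (lens_space j (odds_below j))"

definition folding :: "((nat \<Rightarrow> complex) set \<times> real + unit) set \<Rightarrow> ((nat \<Rightarrow> complex) set \<times> real + unit) set \<Rightarrow> bool" where
  "folding u v \<longleftrightarrow> (\<exists>x \<in> ell_minus j n. x (n - 2) = 0 \<and>
     u = cone_point (lens_space j (odds_below j)) (lens_class j (odds_below j) (coords x)) 0 \<and>
     v = cone_point (lens_space j (odds_below j)) (lens_class j (odds_below j) (coords (antipode x))) 0)"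

definition folded_class :: "(nat \<Rightarrow> complex) \<times> real + unit \<Rightarrow> ((nat \<Rightarrow> complex) set \<times> real + unit) set set" where
  "folded_class s = generated_class folding (generated_class gluing (lens_cylinder s))"

lemma topspace_cylinder:
  "topspace cylinder = (topspace (complex_sphere (j div 2)) \<times> {0..1}) <+> {()}"
  by (simp add: cylinder_def)

lemma topspace_lens_space:
  "topspace (lens_space j (odds_below j)) = lens_class j (odds_below j) ` topspace (complex_sphere (j div 2))"
  using quotient_imp_surjective_map[OF quotient_map_lens_class[of "odds_below j" j]] by simp

text \<open>The product of a quotient map with the identity of the unit interval is again a quotient
  map because the interval is locally compact and Hausdorff; the two gluings are composed with
  it.\<close>

lemma quotient_map_folded_class: "quotient_map cylinder (folded_cone j n) folded_class"
proof -
  let ?L = "lens_space j (odds_below j)"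
  have k: "n div j = 2 * h"
    using j_pos by (simp add: n_eq)
  have "quotient_map (prod_topology (complex_sphere (j div 2)) (top_of_set {0..1::real}))
      (prod_topology ?L (top_of_set {0..1::real})) (\<lambda>(w, t). (lens_class j (odds_below j) w, t))"
  proof (rule quotient_map_prod_left[where f = "lens_class j (odds_below j)"])
    show "locally_compact_space (top_of_set {0..1::real})"
      by (intro compact_imp_locally_compact_space) (simp add: compact_space_subtopology)
    show "Hausdorff_space (top_of_set {0..1::real}) \<or> regular_space (top_of_set {0..1::real})"
      by (simp add: Hausdorff_space_subtopology)
    show "quotient_map (complex_sphere (j div 2)) ?L (lens_class j (odds_below j))"
      using quotient_map_lens_class[of "odds_below j" j] by simp
  qed
  moreover have "quotient_map (discrete_topology {()}) (discrete_topology {()}) id"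
    by (auto simp: quotient_map_def)
  ultimately have "quotient_map cylinder
      (prod_topology ?L (top_of_set {0..1::real}) \<squnion>\<^sub>t discrete_topology {()}) lens_cylinder"
    unfolding cylinder_def lens_cylinder_def by (rule quotient_map_map_sum)
  moreover have "quotient_map (prod_topology ?L (top_of_set {0..1::real}) \<squnion>\<^sub>t discrete_topology {()}) (cone ?L)
      (generated_class gluing)"
    unfolding cone_def identify_def by (rule quotient_map_quotient_topology)
  moreover have "quotient_map (cone ?L) (folded_cone j n) (generated_class folding)"
  proof -
    have "folded_cone j n = identify (cone ?L) folding"
      unfolding folded_cone_def Let_def k block_coords_eq folding_def[abs_def] ..
    then show ?thesis
      unfolding identify_def by (simp only: quotient_map_quotient_topology)
  qed
  ultimately have "quotient_map cylinder (folded_cone j n)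
      (generated_class folding \<circ> (generated_class gluing \<circ> lens_cylinder))"
    by (intro quotient_map_compose)
  then show ?thesis
    by (simp add: comp_def folded_class_def[abs_def])
qed

context
  assumes odd_j: "odd j"
begin

lemma cap_ell_minus:
  assumes "s \<in> topspace cylinder"
  shows "cap s \<in> ell_minus j n"
proof (cases s)
  case (Inl p)
  then obtain w t where s: "s = Inl (w, t)" by (cases p) auto
  have "0 \<le> 1 - t\<^sup>2"
    using assms by (auto simp: s topspace_cylinder abs_square_le_1)
  moreover have "(\<Sum>i<j div 2. (cmod (w i))\<^sup>2) = 1"
    using assms by (auto simp: s topspace_cylinder topspace_complex_sphere)
  ultimately have "(\<Sum>i<j div 2. (cmod (of_real (sqrt (1 - t\<^sup>2)) * w i))\<^sup>2) = 1 - t\<^sup>2"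
    by (simp add: norm_mult power_mult_distrib flip: sum_distrib_left)
  then show ?thesis
    using odd_j by (simp add: s cap_def embed_ell_minus_iff)
next
  case (Inr u)
  then show ?thesis
    using odd_j by (simp add: cap_def embed_ell_minus_iff)
qed

lemma continuous_map_cap:
  "continuous_map cylinder (subtopology (nsphere (n - 2)) (ell_minus j n)) cap"
  unfolding cylinder_def
proof (rule continuous_map_from_disjoint_sum)
  let ?P = "prod_topology (complex_sphere (j div 2)) (top_of_set {0..1::real})"
  have w: "continuous_map ?P euclidean (\<lambda>p. fst p i)" if "i < j div 2" for i
  proof -
    have "continuous_map (complex_sphere (j div 2)) euclidean (\<lambda>w. w i)"
      unfolding complex_sphere_def using that
      by (intro continuous_map_from_subtopology continuous_map_complex_space_coordinate)
    then show ?thesis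
      using continuous_map_compose[OF continuous_map_fst] by (fastforce simp: comp_def)
  qed
  have "continuous_map ?P (top_of_set {0..1}) snd"
    by (rule continuous_map_snd)
  then have t: "continuous_map ?P euclideanreal snd"
    by (simp add: continuous_map_in_subtopology)
  have "continuous_map ?P (subtopology (nsphere (n - 2)) (ell_minus j n))
      (\<lambda>p. embed (\<lambda>i. of_real (sqrt (1 - (snd p)\<^sup>2)) * fst p i) (snd p))"
  proof (rule continuous_map_embed[OF _ t])
    show "continuous_map ?P euclidean (\<lambda>p. of_real (sqrt (1 - (snd p)\<^sup>2)) * fst p i)"
      if "i < j div 2" for i
      using w[OF that] t unfolding continuous_map_euclidean_tendsto by (auto intro!: tendsto_intros)
    show "embed (\<lambda>i. of_real (sqrt (1 - (snd p)\<^sup>2)) * fst p i) (snd p) \<in> ell_minus j n"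
      if "p \<in> topspace ?P" for p
      using cap_ell_minus[of "Inl p"] that by (auto simp: topspace_cylinder cap_def case_prod_unfold)
  qed
  then show "continuous_map ?P (subtopology (nsphere (n - 2)) (ell_minus j n)) (cap \<circ> Inl)"
    by (simp add: comp_def cap_def case_prod_unfold)
  show "continuous_map (discrete_topology {()}) (subtopology (nsphere (n - 2)) (ell_minus j n)) (cap \<circ> Inr)"
    using cap_ell_minus[of "Inr ()"] ell_minus_nsphere
    by (auto simp: topspace_cylinder)
qed

text \<open>Since \<open>j\<close> is odd, \<open>antipode\<close> is an odd power of \<open>rot n\<close> on the sphere, so that every orbit
  meets the half \<open>x (n - 2) \<ge> 0\<close>, which is the image of \<open>cap\<close>.\<close>

lemma cap_surj:
  assumes "x \<in> ell_minus j n"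
  shows "\<exists>s\<in>topspace cylinder. orbit n (cap s) = orbit n x"
proof -
  have half: "\<exists>s\<in>topspace cylinder. cap s = x" if x: "x \<in> ell_minus j n" and pos: "x (n - 2) \<ge> 0" for x
  proof -
    define t where "t = x (n - 2)"
    have ex: "embed (coords x) t = x"
      unfolding t_def by (rule embed_coords[OF x])
    then have norm: "(\<Sum>s<j div 2. (cmod (coords x s))\<^sup>2) + t\<^sup>2 = 1"
      using x odd_j embed_ell_minus_iff[of "coords x" t] by simp
    have "t\<^sup>2 \<le> 1"
      using norm sum_nonneg[of "{..<j div 2}" "\<lambda>s. (cmod (coords x s))\<^sup>2"] by simp
    then have "t \<le> 1" "t \<ge> 0"
      using pos by (auto simp: abs_square_le_1 t_def)
    show ?thesis
    proof (cases "t = 1")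
      \<comment> \<open>At the pole the radius is zero and no direction can be recovered, so the
        isolated point is the preimage.\<close>
      case True
      then have "(\<Sum>s<j div 2. (cmod (coords x s))\<^sup>2) = 0"
        using norm by simp
      then have "\<forall>s<j div 2. coords x s = 0"
        by (simp add: sum_nonneg_eq_0_iff)
      then have "embed (coords x) t = embed (\<lambda>_. 0) 1"
        using True by (simp add: embed_eq_iff)
      then have "cap (Inr ()) = x"
        using ex by (simp add: cap_def)
      then show ?thesis
        by (intro bexI[of _ "Inr ()"]) (auto simp: topspace_cylinder)
    next
      case False
      define \<rho> where "\<rho> = sqrt (1 - t\<^sup>2)"
      have "t\<^sup>2 < 1"
        using False \<open>t \<le> 1\<close> \<open>t \<ge> 0\<close> by (simp add: abs_square_less_1)
      then have \<rho>: "\<rho> > 0" "\<rho>\<^sup>2 = 1 - t\<^sup>2"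
        by (simp_all add: \<rho>_def)
      define w where "w = (\<lambda>s\<in>{..<j div 2}. coords x s / of_real \<rho>)"
      have "(\<Sum>s<j div 2. (cmod (w s))\<^sup>2) = (\<Sum>s<j div 2. (cmod (coords x s))\<^sup>2) / \<rho>\<^sup>2"
        by (simp add: w_def norm_divide power_divide sum_divide_distrib)
      also have "\<dots> = 1"
        using norm \<rho> by (simp add: field_simps)
      finally have "Inl (w, t) \<in> topspace cylinder"
        using \<open>t \<le> 1\<close> \<open>t \<ge> 0\<close> by (auto simp: topspace_cylinder topspace_complex_sphere w_def)
      moreover have "cap (Inl (w, t)) = x"
      proof -
        have "cap (Inl (w, t)) = embed (coords x) t"
          unfolding cap_def using \<rho> by (simp add: embed_eq_iff w_def flip: \<rho>_def)
        then show ?thesis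
          using ex by simp
      qed
      ultimately show ?thesis by blast
    qed
  qed
  show ?thesis
  proof (cases "x (n - 2) \<ge> 0")
    case True
    then show ?thesis
      using half assms by metis
  next
    case False
    then obtain s where s: "s \<in> topspace cylinder" "cap s = antipode x"
      using half[OF antipode_ell_minus[OF assms]] by (auto simp: antipode_def)
    have "antipode x = (rot n ^^ j) x"
      using assms by (simp add: ell_minus_def)
    then have "orbit n (antipode x) = orbit n x"
      using orbit_ell_minus_eq_iff[OF assms antipode_ell_minus[OF assms]] by metis
    then show ?thesis
      using s by metis
  qed
qed

lemma unity_double: "unity (2 * q) (2 * d) = unity q d"
  by (simp add: unity_def field_simps)

text \<open>On the complex coordinates the lens rotation of modulus \<open>j\<close> is the square
  of \<open>rot n\<close>. Even powers are the ones that keep the sign of the last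
  coordinate.\<close>

lemma lens_class_half_eq_iff:
  assumes "w \<in> topspace (complex_sphere (j div 2))" "w' \<in> topspace (complex_sphere (j div 2))"
  shows "lens_class j (odds_below j) w = lens_class j (odds_below j) w' \<longleftrightarrow>
    (\<exists>i. \<forall>s<j div 2. w' s = unity (2 * j) ((2 * int s + 1) * int (2 * i)) * w s)"
proof -
  have "unity (2 * j) ((2 * int s + 1) * int (2 * i)) = unity j ((2 * int s + 1) * int i)" for s i
    using unity_double[of j "(2 * int s + 1) * int i"] by (simp add: mult.left_commute)
  then show ?thesis
    using assms j_pos lens_class_eq_iff[of j w "odds_below j" w'] by simp
qed

text \<open>Equal lens classes are joined by an even power of \<open>rot n\<close>, which also fixes
  the height.\<close>

lemma lens_cylinder_eqD:
  assumes "s \<in> topspace cylinder" "s' \<in> topspace cylinder" "lens_cylinder s = lens_cylinder s'"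
  shows "orbit n (cap s) = orbit n (cap s')"
proof (cases s)
  case (Inl p)
  then obtain w t where s: "s = Inl (w, t)" by (cases p) auto
  then obtain w' where s': "s' = Inl (w', t)"
    and eq: "lens_class j (odds_below j) w = lens_class j (odds_below j) w'"
    using assms(3) by (cases s') (auto simp: lens_cylinder_def)
  have "w \<in> topspace (complex_sphere (j div 2))" "w' \<in> topspace (complex_sphere (j div 2))"
    using assms s s' by (auto simp: topspace_cylinder)
  then obtain i where "\<forall>s<j div 2. w' s = unity (2 * j) ((2 * int s + 1) * int (2 * i)) * w s"
    using eq lens_class_half_eq_iff by blast
  then have "cap s' = (rot n ^^ (2 * i)) (cap s)"
    by (simp add: s s' cap_def rot_power_embed embed_eq_iff)
  then show ?thesis
    using orbit_ell_minus_eq_iff cap_ell_minus assms by blast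
next
  case (Inr u)
  then show ?thesis
    using assms(3) by (cases s') (auto simp: lens_cylinder_def)
qed

text \<open>The orbit of the cap point is a function on the cylinder that descends through every
  identification: \<open>P1\<close> is its version on the lens cylinder and \<open>P2\<close> on the
  cone. Invariance of \<open>P2\<close> under \<open>folding\<close> makes it constant on folded
  classes.\<close>

lemma folded_class_eqD:
  assumes s: "s \<in> topspace cylinder" "s' \<in> topspace cylinder" and eq: "folded_class s = folded_class s'"
  shows "orbit n (cap s) = orbit n (cap s')"
proof -
  let ?p = "odds_below j"
  \<comment> \<open>The choice of preimage does not affect the orbit, by
    \<open>lens_cylinder_eqD\<close>.\<close>
  define P1 where "P1 v = orbit n (cap (inv_into (topspace cylinder) lens_cylinder v))" for v
  have P1: "P1 (lens_cylinder s) = orbit n (cap s)" if "s \<in> topspace cylinder" for s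
    unfolding P1_def using that
    by (intro lens_cylinder_eqD) (auto intro: inv_into_into f_inv_into_f)
  have P1_gluing: "P1 u = P1 v" if "gluing u v" for u v
  proof -
    obtain w where w: "w \<in> topspace (complex_sphere (j div 2))" "u = Inl (lens_class j ?p w, 1)" "v = Inr ()"
      using \<open>gluing u v\<close> by (auto simp: cone_gluing_def topspace_lens_space)
    have "u = lens_cylinder (Inl (w, 1))" "v = lens_cylinder (Inr ())"
      using w by (auto simp: lens_cylinder_def)
    \<comment> \<open>At height 1 the radius is zero, so every direction gives the pole.\<close>
    moreover have "cap (Inl (w, 1)) = cap (Inr ())"
      by (simp add: cap_def embed_eq_iff)
    moreover have "Inl (w, 1) \<in> topspace cylinder" "Inr () \<in> topspace cylinder"
      using w by (auto simp: topspace_cylinder)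
    ultimately show ?thesis
      using P1 by metis
  qed
  define P2 where "P2 C = P1 (SOME v. generated_class gluing v = C)" for C
  have P2: "P2 (generated_class gluing v) = P1 v" for v
  proof -
    have "generated_class gluing (SOME v'. generated_class gluing v' = generated_class gluing v)
        = generated_class gluing v"
      by (rule someI) (rule refl)
    then show ?thesis
      unfolding P2_def by (rule generated_class_invariant) (rule P1_gluing)
  qed
  have P2_base: "P2 (cone_point (lens_space j ?p) (lens_class j ?p (coords x)) 0) = orbit n x"
    if x: "x \<in> ell_minus j n" "x (n - 2) = 0" for x
  proof -
    have ex: "embed (coords x) 0 = x"
      using embed_coords[OF x(1)] x(2) by simp
    then have mem: "Inl (coords x, 0) \<in> topspace cylinder"
      using x(1) odd_j embed_ell_minus_iff[of "coords x" 0]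
      by (auto simp: topspace_cylinder topspace_complex_sphere coords_def)
    have "cone_point (lens_space j ?p) (lens_class j ?p (coords x)) 0
        = generated_class gluing (lens_cylinder (Inl (coords x, 0)))"
      by (simp add: cone_point_def lens_cylinder_def)
    moreover have "cap (Inl (coords x, 0)) = x"
      using ex by (simp add: cap_def)
    ultimately show ?thesis
      by (simp only: P2 P1[OF mem])
  qed
  have P2_folding: "P2 u = P2 v" if folding: "folding u v" for u v
  proof -
    obtain x where x: "x \<in> ell_minus j n" "x (n - 2) = 0"
      and uv: "u = cone_point (lens_space j ?p) (lens_class j ?p (coords x)) 0"
        "v = cone_point (lens_space j ?p) (lens_class j ?p (coords (antipode x))) 0"
      using folding unfolding folding_def by blast
    have "antipode x (n - 2) = 0"
      using x(2) by (simp add: antipode_def)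
    then have "P2 u = orbit n x" "P2 v = orbit n (antipode x)"
      unfolding uv using P2_base x antipode_ell_minus by blast+
    moreover have "antipode x = (rot n ^^ j) x"
      using x by (simp add: ell_minus_def)
    ultimately show ?thesis
      using orbit_ell_minus_eq_iff[OF x(1) antipode_ell_minus[OF x(1)]] by metis
  qed
  have "P2 (generated_class gluing (lens_cylinder s)) = P2 (generated_class gluing (lens_cylinder s'))"
    using eq unfolding folded_class_def by (rule generated_class_invariant) (rule P2_folding)
  then show ?thesis
    using s by (simp add: P2 P1)
qed

lemma folded_class_top:
  assumes "w \<in> topspace (complex_sphere (j div 2))"
  shows "folded_class (Inl (w, 1)) = folded_class (Inr ())"
proof -
  have "gluing (lens_cylinder (Inl (w, 1))) (lens_cylinder (Inr ()))"
    using assms by (auto simp: cone_gluing_def lens_cylinder_def topspace_lens_space)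
  then show ?thesis
    by (simp add: folded_class_def generated_class_cong[of gluing])
qed

text \<open>On the sphere \<open>rot n ^^ j\<close> is -1, so an odd power \<open>i\<close> is the
  antipodal map followed by the even power \<open>i + j\<close>. The fold joins the classes of
  \<open>w\<close> and its negative, and the even power stays in the lens class.\<close>

lemma folded_class_base:
  assumes w: "w \<in> topspace (complex_sphere (j div 2))" and w': "w' \<in> topspace (complex_sphere (j div 2))"
    and "odd i" and eq: "\<And>s. s < j div 2 \<Longrightarrow> w' s = unity (2 * j) ((2 * int s + 1) * int i) * w s"
  shows "folded_class (Inl (w, 0)) = folded_class (Inl (w', 0))"
proof -
  let ?p = "odds_below j" and ?neg = "\<lambda>s\<in>{..<j div 2}. - w s"
  define x where "x = embed w 0"
  have x: "x \<in> ell_minus j n" "x (n - 2) = 0"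
    using w odd_j by (simp_all add: x_def embed_ell_minus_iff embed_last topspace_complex_sphere)
  have coords: "coords x = w" "coords (antipode x) = ?neg"
    using w by (auto simp: x_def coords_antipode coords_embed topspace_complex_sphere extensional_restrict)
  have neg: "?neg \<in> topspace (complex_sphere (j div 2))"
    using w by (simp add: topspace_complex_sphere)
  obtain i' where i': "i + j = 2 * i'"
    using \<open>odd i\<close> odd_j by (metis evenE odd_even_add)
  have "unity (2 * j) ((2 * int s + 1) * int i) = - unity (2 * j) ((2 * int s + 1) * int (2 * i'))" for s
  proof -
    \<comment> \<open>The summand \<open>j\<close> contributes the factor -1, the multiple of
      \<open>2 * j\<close> the factor 1.\<close>
    have "(2 * int s + 1) * int (2 * i') = (2 * int s + 1) * int i + int j + int (2 * j) * int s"
      unfolding i'[symmetric] by (simp add: algebra_simps)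
    moreover have "unity (2 * j) (int j) = - 1"
      using j_pos by (simp add: unity_def)
    ultimately show ?thesis
      using unity_multiple[of "2 * j" "int s"] j_pos by (simp only: unity_add) simp
  qed
  then have "\<forall>s<j div 2. w' s = unity (2 * j) ((2 * int s + 1) * int (2 * i')) * ?neg s"
    using eq by simp
  then have "lens_class j ?p ?neg = lens_class j ?p w'"
    using lens_class_half_eq_iff[OF neg w'] by blast
  then have "folding (cone_point (lens_space j ?p) (lens_class j ?p w) 0)
      (cone_point (lens_space j ?p) (lens_class j ?p w') 0)"
    unfolding folding_def using x coords by metis
  then show ?thesis
    by (simp add: folded_class_def cone_point_def lens_cylinder_def generated_class_cong[of folding])
qed

text \<open>Heights are nonnegative and \<open>rot n ^^ i\<close> multiplies them by
  \<open>(- 1) ^ i\<close>. An even \<open>i\<close> keeps the height and relates lens classes, the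
  pole being treated apart because it has no direction; an odd \<open>i\<close> forces height 0,
  where the fold applies.\<close>

lemma orbit_cap_eqD:
  assumes s: "s \<in> topspace cylinder" "s' \<in> topspace cylinder" and eq: "orbit n (cap s) = orbit n (cap s')"
  shows "folded_class s = folded_class s'"
proof -
  have apex: "folded_class (Inl (w, t)) = folded_class (Inr ())"
    if mem: "Inl (w, t) \<in> topspace cylinder" and orb: "orbit n (cap (Inl (w, t))) = orbit n (cap (Inr ()))" for w t
  proof -
    have "Inr () \<in> topspace cylinder"
      by (auto simp: topspace_cylinder)
    then obtain i where "cap (Inr ()) = (rot n ^^ i) (cap (Inl (w, t)))"
      using orb orbit_ell_minus_eq_iff cap_ell_minus mem by metis
    then have "1 = (- 1) ^ i * t"
      using odd_j by (simp add: cap_def rot_power_embed embed_eq_iff)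
    moreover have "0 \<le> t" "t \<le> 1"
      using mem by (auto simp: topspace_cylinder)
    ultimately have "t = 1"
      by (cases "even i") auto
    then show ?thesis
      using folded_class_top mem by (auto simp: topspace_cylinder)
  qed
  have main: "folded_class (Inl (w, t)) = folded_class (Inl (w', t'))"
    if mem: "Inl (w, t) \<in> topspace cylinder" "Inl (w', t') \<in> topspace cylinder"
      and orb: "orbit n (cap (Inl (w, t))) = orbit n (cap (Inl (w', t')))" for w t w' t'
  proof -
    have w: "w \<in> topspace (complex_sphere (j div 2))" and w': "w' \<in> topspace (complex_sphere (j div 2))"
      and t: "0 \<le> t" "t \<le> 1" "0 \<le> t'" "t' \<le> 1"
      using mem by (auto simp: topspace_cylinder)
    obtain i where "cap (Inl (w', t')) = (rot n ^^ i) (cap (Inl (w, t)))"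
      using orb orbit_ell_minus_eq_iff cap_ell_minus mem by metis
    then have t': "t' = (- 1) ^ i * t"
      and ww': "\<And>s. s < j div 2 \<Longrightarrow> of_real (sqrt (1 - t'\<^sup>2)) * w' s =
        unity (2 * j) ((2 * int s + 1) * int i) * (of_real (sqrt (1 - t\<^sup>2)) * w s)"
      using odd_j by (auto simp: cap_def rot_power_embed embed_eq_iff)
    show ?thesis
    proof (cases "even i")
      case True
      then have tt: "t' = t"
        using t' by simp
      show ?thesis
      proof (cases "t = 1")
        case True
        then show ?thesis
          using folded_class_top w w' tt by simp
      next
        case False
        then have "t\<^sup>2 < 1"
          using t by (simp add: abs_square_less_1)
        then have "complex_of_real (sqrt (1 - t\<^sup>2)) \<noteq> 0"
          by simp
        then have "w' s = unity (2 * j) ((2 * int s + 1) * int i) * w s" if "s < j div 2" for s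
          using ww'[OF that] tt by (simp add: mult.left_commute)
        moreover obtain i' where "i = 2 * i'"
          using True by blast
        ultimately have "lens_class j (odds_below j) w = lens_class j (odds_below j) w'"
          using lens_class_half_eq_iff[OF w w'] by blast
        then show ?thesis
          by (simp add: folded_class_def lens_cylinder_def tt)
      qed
    next
      case False
      then have "t' = - t"
        using t' by simp
      then have "t = 0" "t' = 0"
        using t by auto
      then show ?thesis
        using folded_class_base[OF w w' False] ww' by simp
    qed
  qed
  show ?thesis
  proof (cases s)
    case (Inl p)
    then obtain w t where sw: "s = Inl (w, t)" by (cases p) auto
    show ?thesis
    proof (cases s')
      case (Inl p')
      then obtain w' t' where "s' = Inl (w', t')" by (cases p') auto
      then show ?thesis
        using main s eq sw by blast
    qed (use apex s eq sw in auto)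
  next
    case (Inr u)
    show ?thesis
    proof (cases s')
      case (Inl p')
      then obtain w' t' where "s' = Inl (w', t')" by (cases p') auto
      then show ?thesis
        using apex[of w' t'] s eq Inr by simp
    qed (use Inr in simp)
  qed
qed

lemma ell_minus_odd:
  "orbit_space (nsphere (n - 2)) {rot n, antipode} (ell_minus j n) homeomorphic_space folded_cone j n"
proof (rule homeomorphic_space_same_fibres)
  have "compact_space cylinder"
    unfolding cylinder_def using compact_space_complex_sphere
    by (intro compact_space_disjoint_sum)
      (auto simp: compact_space_prod_topology compact_space_subtopology compact_space_discrete_topology)
  then show "quotient_map cylinder (orbit_space (nsphere (n - 2)) {rot n, antipode} (ell_minus j n))
      (\<lambda>s. orbit n (cap s))"
    using continuous_map_cap cap_surj by (rule quotient_map_orbit_ell_minus)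
  show "quotient_map cylinder (folded_cone j n) folded_class"
    by (rule quotient_map_folded_class)
  show "orbit n (cap s) = orbit n (cap s') \<longleftrightarrow> folded_class s = folded_class s'"
    if "s \<in> topspace cylinder" "s' \<in> topspace cylinder" for s s'
    using folded_class_eqD orbit_cap_eqD that by blast
qed

end

end

section \<open>The quotient of the union\<close>

text \<open>The two parts are equalisers of continuous maps into a Hausdorff space, hence closed,
  and invariance of \<open>ell_plus j n\<close> keeps orbits from mixing them. \<open>Z\<close> is
  arbitrary so that the lens space and the folded cone share the argument.\<close>

lemma ell_quotient_homeomorphic_sum:
  assumes n: "n \<ge> 2" and j: "j dvd n"
    and Z: "orbit_space (nsphere (n - 2)) {rot n, antipode} (ell_minus j n) homeomorphic_space Z"
  shows "ell_quotient j n homeomorphic_space linear_shapes j \<squnion>\<^sub>t Z"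
proof -
  interpret fixed_sphere n j
    by unfold_locales fact+
  let ?S = "nsphere (n - 2)" and ?P = "ell_plus j n" and ?M = "ell_minus j n"
  let ?X = "subtopology ?S (ell j n)"
  let ?f = "\<lambda>x. shape_orbit j (samples n j x)"
  have topX: "topspace ?X = ?P \<union> ?M"
    by (auto simp: ell_def ell_plus_def ell_minus_def)
  have topM: "topspace (subtopology ?S ?M) = ?M"
    by (auto simp: ell_minus_def)
  have PS: "x \<in> topspace ?S" if "x \<in> ?P \<union> ?M" for x
    using that by (auto simp: ell_plus_def ell_minus_def)
  have disj: "?P \<inter> ?M = {}"
  proof -
    \<comment> \<open>The only fixed point of \<open>antipode\<close> is the origin, which is not on
      the sphere.\<close>
    have "x = (\<lambda>_. 0)" if "x = antipode x" for x
      using that by (auto simp: antipode_def fun_eq_iff)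
    then show ?thesis
      using nsphere_nonzero by (auto simp: ell_plus_def ell_minus_def) metis
  qed
  have subs: "subtopology ?X ?P = subtopology ?S ?P" "subtopology ?X ?M = subtopology ?S ?M"
    by (simp_all add: subtopology_subtopology ell_def Int_absorb1)
  have "Hausdorff_space ?S"
    unfolding nsphere_def by (intro Hausdorff_space_subtopology Hausdorff_Euclidean_space)
  have cont: "continuous_map ?X ?S (rot n ^^ j)" "continuous_map ?X ?S antipode" "continuous_map ?X ?S id"
  proof -
    have "continuous_map ?S ?S (rot n ^^ i)" for i
    proof (induction i)
      case (Suc i)
      then show ?case
        unfolding funpow.simps(2) using continuous_map_rot[OF n] by (rule continuous_map_compose)
    qed (simp add: id_def)
    then show "continuous_map ?X ?S (rot n ^^ j)"
      by (rule continuous_map_from_subtopology)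
    show "continuous_map ?X ?S antipode"
      by (rule continuous_map_from_subtopology[OF continuous_map_antipode[OF n]])
    show "continuous_map ?X ?S id"
      by (simp add: continuous_map_from_subtopology)
  qed
  have "?P = {x \<in> topspace ?X. (rot n ^^ j) x = id x}" "?M = {x \<in> topspace ?X. (rot n ^^ j) x = antipode x}"
    unfolding topX using disj by (auto simp: ell_plus_def ell_minus_def)
  then have closed: "closedin ?X ?P" "closedin ?X ?M"
    using closedin_continuous_maps_eq[OF \<open>Hausdorff_space ?S\<close> cont(1) cont(3)]
      closedin_continuous_maps_eq[OF \<open>Hausdorff_space ?S\<close> cont(1) cont(2)] by simp_all
  have qM: "quotient_map (subtopology ?S ?M) (orbit_space ?S {rot n, antipode} ?M) (orbit n)"
    unfolding orbit_space_def orbit_def by (rule quotient_map_quotient_topology)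
  obtain g where g: "quotient_map (subtopology ?S ?M) Z g"
    and g_eq: "\<And>x y. x \<in> ?M \<Longrightarrow> y \<in> ?M \<Longrightarrow> g x = g y \<longleftrightarrow> orbit n x = orbit n y"
    using quotient_map_homeomorphic_space[OF qM Z] unfolding topM by metis
  let ?h = "\<lambda>x. if x \<in> ?P then Inl (?f x) else Inr (g x)"
  have q: "quotient_map ?X (ell_quotient j n) (orbit n)"
    unfolding ell_quotient_def orbit_space_def orbit_def by (rule quotient_map_quotient_topology)
  have h: "quotient_map ?X (linear_shapes j \<squnion>\<^sub>t Z) ?h"
    using closed topX disj quotient_map_ell_plus g
    by (intro quotient_map_disjoint_union[of _ ?P ?M]) (simp_all add: subs)
  have separate: "orbit n x \<noteq> orbit n y" if xy: "x \<in> ?P" "y \<in> ?M" for x y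
  proof
    assume "orbit n x = orbit n y"
    then obtain i where "y = (rot n ^^ i) x \<or> y = antipode ((rot n ^^ i) x)"
      using orbit_eq_iff[OF n] PS xy by blast
    then have "y \<in> ?P"
      using rot_power_ell_plus antipode_ell_plus xy by blast
    then show False
      using xy disj by blast
  qed
  have "orbit n x = orbit n y \<longleftrightarrow> ?h x = ?h y" if "x \<in> topspace ?X" "y \<in> topspace ?X" for x y
    using that shape_orbit_samples_eq_iff[of x y] g_eq[of x y] separate[of x y] separate[of y x]
    unfolding topX by (cases "x \<in> ?P"; cases "y \<in> ?P") auto
  then show ?thesis
    by (rule homeomorphic_space_same_fibres[OF q h])
qed

lemma ell_quotient_homeomorphic_linear_shapes:
  assumes n: "n \<ge> 2" and j: "j dvd n" and "ell_minus j n = {}"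
  shows "ell_quotient j n homeomorphic_space linear_shapes j"
proof -
  interpret fixed_sphere n j
    by unfold_locales fact+
  let ?X = "subtopology (nsphere (n - 2)) (ell_plus j n)"
  have "ell j n = ell_plus j n"
    using assms(3) by (simp add: ell_def)
  then have q: "quotient_map ?X (ell_quotient j n) (orbit n)"
    unfolding ell_quotient_def orbit_space_def orbit_def by (simp add: quotient_map_quotient_topology)
  show ?thesis
    by (rule homeomorphic_space_same_fibres[OF q quotient_map_ell_plus])
      (simp add: shape_orbit_samples_eq_iff)
qed

text \<open>If \<open>R\<^sup>j x = - x\<close> then \<open>R\<^sup>n x = (- 1)\<^sup>k x\<close>, while \<open>R\<close> has order dividing \<open>n\<close>.\<close>

lemma ell_minus_empty:
  assumes n: "n \<ge> 2" and "n = j * k" "odd k"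
  shows "ell_minus j n = {}"
proof (rule ccontr)
  assume "ell_minus j n \<noteq> {}"
  then obtain x where x: "x \<in> topspace (nsphere (n - 2))" "(rot n ^^ j) x = antipode x"
    by (auto simp: ell_minus_def)
  have "(rot n ^^ (j * i)) x = (if even i then x else antipode x)" for i
    by (induction i) (auto simp: funpow_add rot_power_antipode x(2))
  then have "(rot n ^^ n) x = antipode x"
    using assms by simp
  moreover have "(rot n ^^ n) x = x"
    using x n by (simp add: rot_order topspace_nsphere_iff)
  ultimately have "x = (\<lambda>_. 0)"
    by (auto simp: antipode_def fun_eq_iff)
  then show False
    using x nsphere_nonzero by blast
qed

theorem theorem5p9:
  fixes n j k :: nat
  assumes "n \<ge> 3" and "\<not> prime n"
    and "j dvd n" and "0 < j" and "j < n"
    and "k = n div j"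
  shows "(odd k \<longrightarrow> ell_quotient j n homeomorphic_space linear_shapes j) \<and>
    (even k \<and> even j \<longrightarrow>
       ell_quotient j n homeomorphic_space
         linear_shapes j \<squnion>\<^sub>t lens_space (2 * j) (odds_below j)) \<and>
    (even k \<and> odd j \<longrightarrow>
       ell_quotient j n homeomorphic_space linear_shapes j \<squnion>\<^sub>t folded_cone j n)"
proof -
  have n: "n \<ge> 2" and jk: "n = j * k" and "k > 0"
    using assms by (auto simp: div_greater_zero_iff dvd_imp_le)
  \<comment> \<open>For even \<open>k\<close> the half index is \<open>h = k div 2\<close>, so that
    \<open>n = 2 * h * j\<close>; it is positive because \<open>k\<close> is.\<close>
  have sphere: "antipodal_sphere n j (k div 2)" if "even k"
    using that jk \<open>k > 0\<close> \<open>0 < j\<close> by unfold_locales (auto elim!: evenE)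
  have "ell_quotient j n homeomorphic_space linear_shapes j \<squnion>\<^sub>t lens_space (2 * j) (odds_below j)"
    if "even k" "even j"
    using ell_quotient_homeomorphic_sum[OF n \<open>j dvd n\<close> antipodal_sphere.ell_minus_even[OF sphere[OF that(1)] that(2)]] .
  moreover have "ell_quotient j n homeomorphic_space linear_shapes j \<squnion>\<^sub>t folded_cone j n"
    if "even k" "odd j"
    using ell_quotient_homeomorphic_sum[OF n \<open>j dvd n\<close> antipodal_sphere.ell_minus_odd[OF sphere[OF that(1)] that(2)]] .
  moreover have "ell_quotient j n homeomorphic_space linear_shapes j" if "odd k"
    using ell_quotient_homeomorphic_linear_shapes[OF n \<open>j dvd n\<close> ell_minus_empty[OF n jk that]] .
  ultimately show ?thesis
    by blast
qed

end
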